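(* Let $A$ be a generalized Cartan matrix with associated data $\mathfrak h_{\mathbb R}^*,\Pi,W,\overline C$, let $\mu\in\overline C$, let $H$ be the convex hull of $W\mu$, and for $I\subseteq\Pi$ let $F_I$ be the convex hull of $W_I\mu$ (a face of $H$). (a) Let $I,I'\subseteq\Pi$ be $\mu$-connected and $w\in{}^{I}W^{I'}$. Then $$F_I\cap wF_{I'}=\begin{cases}F_{(I\cap wI')^*}&\text{if }w\in W_{J_0},\\ \emptyset&\text{if }w\notin W_{J_0}.\end{cases}$$ (b) Let $I,I'\subseteq\Pi$ be $\mu$-connected and $w\in{}^{I_*}W^{I'_*}$. Then $I\cup I'\cup\operatorname{red}(w)$ is $\mu$-connected and $$F_I\vee wF_{I'}=F_{I\cup I'\cup\operatorname{red}(w)}.$$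
   Context: Let $A=(a_{ij})_{i,j=1}^m$ be a generalized Cartan matrix (integral, $a_{ii}=2$, $a_{ij}\le 0$ for $i\ne j$, $a_{ij}=0\Rightarrow a_{ji}=0$) of rank $l$. Let $(\mathfrak h_{\mathbb R},\Pi,\Pi^\vee)$ be a realization of $A$ over $\mathbb R$: $\mathfrak h_{\mathbb R}$ is a real vector space of dimension $2m-l$, and $\Pi=\{\alpha_1,\dots,\alpha_m\}\subset\mathfrak h_{\mathbb R}^*$ and $\Pi^\vee=\{\alpha_1^\vee,\dots,\alpha_m^\vee\}\subset\mathfrak h_{\mathbb R}$ are linearly independent with $\langle\alpha_j,\alpha_i^\vee\rangle=a_{ij}$. The Weyl group $W\subset GL(\mathfrak h_{\mathbb R}^* )$ is generated by the reflections $r_{\alpha_i}(\eta)=\eta-\langle\eta,\alpha_i^\vee\rangle\alpha_i$; it is a Coxeter group with these generators. For $I\subseteq\Pi$, $W_I$ is the subgroup generated by $r_\alpha$, $\alpha\in I$. For $I,J\subseteq\Pi$, ${}^{I}W^{J}$ is the set of minimal (length) double coset representatives of $W_I\backslash W/W_J$. The fundamental chamber is $\overline C=\{\eta\in\mathfrak h_{\mathbb R}^*\mid\langle\eta,\alpha^\vee\rangle\ge 0\ \forall\alpha\in\Pi\}$. If $w=r_{\alpha_{i_1}}\cdots r_{\alpha_{i_k}}$ is a reduced expression, $\operatorname{red}(w)=\{\alpha_{i_1},\dots,\alpha_{i_k}\}\subseteq\Pi$ (independent of the reduced expression); $\operatorname{red}(1)=\emptyset$. Set $J_0=\{\alpha\in\Pi\mid\langle\mu,\alpha^\vee\rangle=0\}$.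 Connected components of a subset of $\Pi$ are taken in the Dynkin diagram of $A$ (distinct $\alpha,\beta\in\Pi$ are adjacent iff $\langle\alpha,\beta^\vee\rangle\ne 0$). A subset $I\subseteq\Pi$ is $\mu$-connected if no connected component of $I$ is contained in $J_0$ (the empty set is $\mu$-connected). For $K\subseteq\Pi$, $K^*$ is the biggest $\mu$-connected subset of $K$. For $\mu$-connected $I$, $I_*=\{\alpha\in J_0\setminus I\mid r_\alpha r_\beta=r_\beta r_\alpha\ \forall\beta\in I\}$. Here $wI'=\{w\alpha\mid\alpha\in I'\}$, and $I\cap wI'\subseteq\Pi$. A face of the convex set $H$ is a convex subset $F\subseteq H$ such that every closed line segment in $H$ having a relative interior point in $F$ has both endpoints in $F$. The set of all faces, ordered by inclusion, is a lattice with meet $\cap$ and join $\vee$ ($F\vee F'$ is the smallest face containing $F$ and $F'$). *)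

theory Defs
  imports "HOL-Analysis.Analysis" "HOL-Algebra.Generated_Groups"
begin

definition generalized_cartan_matrix :: "int^'i^'i \<Rightarrow> bool" where
  "generalized_cartan_matrix A \<longleftrightarrow>
     (\<forall>i. A $ i $ i = 2) \<and>
     (\<forall>i j. i \<noteq> j \<longrightarrow> A $ i $ j \<le> 0) \<and>
     (\<forall>i j. A $ i $ j = 0 \<longrightarrow> A $ j $ i = 0)"

text \<open>
  The space \<open>h\<close> is the type \<open>'h\<close> and its dual is \<open>'h \<Rightarrow>\<^sub>L real\<close>: in finite dimension every linear
  functional is bounded. The inner product of \<open>'h\<close> plays no role. The families of
  simple roots \<open>\<alpha>\<close> and simple coroots \<open>\<alpha>v\<close> are indexed by the finite index type \<open>'i\<close> of the matrix.
\<close>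

definition realization ::
    "int^'i^'i \<Rightarrow> ('i::finite \<Rightarrow> 'h::euclidean_space \<Rightarrow>\<^sub>L real) \<Rightarrow> ('i \<Rightarrow> 'h) \<Rightarrow> bool" where
  "realization A \<alpha> \<alpha>v \<longleftrightarrow>
     DIM('h) = 2 * CARD('i) - rank (\<chi> i j. real_of_int (A $ i $ j)) \<and>
     inj \<alpha> \<and> independent (range \<alpha>) \<and>
     inj \<alpha>v \<and> independent (range \<alpha>v) \<and>
     (\<forall>i j. blinfun_apply (\<alpha> j) (\<alpha>v i) = real_of_int (A $ i $ j))"

text \<open>
  Subsets of \<open>\<Pi> = range \<alpha>\<close> are sets of functionals, not of indices, so that \<open>I \<inter> w ` I'\<close> makes
  sense. Accordingly \<open>coroot \<alpha> \<alpha>v \<beta>\<close> is the coroot of a simple root \<open>\<beta> \<in> range \<alpha>\<close> (\<open>\<alpha>\<close> is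
  injective in a realization); it is only meaningful for such \<open>\<beta>\<close>.
\<close>

definition coroot ::
    "('i \<Rightarrow> 'h::real_normed_vector \<Rightarrow>\<^sub>L real) \<Rightarrow> ('i \<Rightarrow> 'h) \<Rightarrow> ('h \<Rightarrow>\<^sub>L real) \<Rightarrow> 'h" where
  "coroot \<alpha> \<alpha>v \<beta> = \<alpha>v (inv_into UNIV \<alpha> \<beta>)"

definition refl ::
    "('i \<Rightarrow> 'h::real_normed_vector \<Rightarrow>\<^sub>L real) \<Rightarrow> ('i \<Rightarrow> 'h) \<Rightarrow> ('h \<Rightarrow>\<^sub>L real)
      \<Rightarrow> ('h \<Rightarrow>\<^sub>L real) \<Rightarrow> ('h \<Rightarrow>\<^sub>L real)" where
  "refl \<alpha> \<alpha>v \<beta> \<eta> = \<eta> - blinfun_apply \<eta> (coroot \<alpha> \<alpha>v \<beta>) *\<^sub>R \<beta>"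

definition GL :: "('v::real_vector \<Rightarrow> 'v) monoid" where
  "GL = \<lparr>carrier = {f. linear f \<and> bij f}, monoid.mult = (\<circ>), one = id\<rparr>"

definition parabolic ::
    "('i \<Rightarrow> 'h::real_normed_vector \<Rightarrow>\<^sub>L real) \<Rightarrow> ('i \<Rightarrow> 'h) \<Rightarrow> ('h \<Rightarrow>\<^sub>L real) set
      \<Rightarrow> (('h \<Rightarrow>\<^sub>L real) \<Rightarrow> ('h \<Rightarrow>\<^sub>L real)) set" where
  "parabolic \<alpha> \<alpha>v I = generate GL (refl \<alpha> \<alpha>v ` I)"

definition weyl_group ::
    "('i \<Rightarrow> 'h::real_normed_vector \<Rightarrow>\<^sub>L real) \<Rightarrow> ('i \<Rightarrow> 'h)
      \<Rightarrow> (('h \<Rightarrow>\<^sub>L real) \<Rightarrow> ('h \<Rightarrow>\<^sub>L real)) set" where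
  "weyl_group \<alpha> \<alpha>v = parabolic \<alpha> \<alpha>v (range \<alpha>)"

definition expression_of ::
    "('i \<Rightarrow> 'h::real_normed_vector \<Rightarrow>\<^sub>L real) \<Rightarrow> ('i \<Rightarrow> 'h)
      \<Rightarrow> ('h \<Rightarrow>\<^sub>L real) list \<Rightarrow> (('h \<Rightarrow>\<^sub>L real) \<Rightarrow> ('h \<Rightarrow>\<^sub>L real)) \<Rightarrow> bool" where
  "expression_of \<alpha> \<alpha>v \<beta>s w \<longleftrightarrow>
     set \<beta>s \<subseteq> range \<alpha> \<and> w = foldr (\<circ>) (map (refl \<alpha> \<alpha>v) \<beta>s) id"

definition len ::
    "('i \<Rightarrow> 'h::real_normed_vector \<Rightarrow>\<^sub>L real) \<Rightarrow> ('i \<Rightarrow> 'h)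
      \<Rightarrow> (('h \<Rightarrow>\<^sub>L real) \<Rightarrow> ('h \<Rightarrow>\<^sub>L real)) \<Rightarrow> nat" where
  "len \<alpha> \<alpha>v w = (LEAST n. \<exists>\<beta>s. expression_of \<alpha> \<alpha>v \<beta>s w \<and> length \<beta>s = n)"

text \<open>
  The set of letters of a reduced expression does not depend on that expression,
  so any choice gives the same set.
\<close>

definition red ::
    "('i \<Rightarrow> 'h::real_normed_vector \<Rightarrow>\<^sub>L real) \<Rightarrow> ('i \<Rightarrow> 'h)
      \<Rightarrow> (('h \<Rightarrow>\<^sub>L real) \<Rightarrow> ('h \<Rightarrow>\<^sub>L real)) \<Rightarrow> ('h \<Rightarrow>\<^sub>L real) set" where
  "red \<alpha> \<alpha>v w = set (SOME \<beta>s. expression_of \<alpha> \<alpha>v \<beta>s w \<and> length \<beta>s = len \<alpha> \<alpha>v w)"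

definition min_double_coset_reps ::
    "('i \<Rightarrow> 'h::real_normed_vector \<Rightarrow>\<^sub>L real) \<Rightarrow> ('i \<Rightarrow> 'h)
      \<Rightarrow> ('h \<Rightarrow>\<^sub>L real) set \<Rightarrow> ('h \<Rightarrow>\<^sub>L real) set
      \<Rightarrow> (('h \<Rightarrow>\<^sub>L real) \<Rightarrow> ('h \<Rightarrow>\<^sub>L real)) set" where
  "min_double_coset_reps \<alpha> \<alpha>v I J =
     {w \<in> weyl_group \<alpha> \<alpha>v. \<forall>a \<in> parabolic \<alpha> \<alpha>v I. \<forall>b \<in> parabolic \<alpha> \<alpha>v J.
        len \<alpha> \<alpha>v w \<le> len \<alpha> \<alpha>v (a \<circ> w \<circ> b)}"

definition fundamental_chamber :: "('i \<Rightarrow> 'h::real_normed_vector) \<Rightarrow> ('h \<Rightarrow>\<^sub>L real) set" where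
  "fundamental_chamber \<alpha>v = {\<eta>. \<forall>i. blinfun_apply \<eta> (\<alpha>v i) \<ge> 0}"

definition J0 ::
    "('i \<Rightarrow> 'h::real_normed_vector \<Rightarrow>\<^sub>L real) \<Rightarrow> ('i \<Rightarrow> 'h) \<Rightarrow> ('h \<Rightarrow>\<^sub>L real)
      \<Rightarrow> ('h \<Rightarrow>\<^sub>L real) set" where
  "J0 \<alpha> \<alpha>v \<mu> = {\<beta> \<in> range \<alpha>. blinfun_apply \<mu> (coroot \<alpha> \<alpha>v \<beta>) = 0}"

definition dynkin_adj ::
    "('i \<Rightarrow> 'h::real_normed_vector \<Rightarrow>\<^sub>L real) \<Rightarrow> ('i \<Rightarrow> 'h)
      \<Rightarrow> (('h \<Rightarrow>\<^sub>L real) \<times> ('h \<Rightarrow>\<^sub>L real)) set" where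
  "dynkin_adj \<alpha> \<alpha>v = {(\<beta>, \<gamma>). \<beta> \<in> range \<alpha> \<and> \<gamma> \<in> range \<alpha> \<and> \<beta> \<noteq> \<gamma> \<and>
     blinfun_apply \<beta> (coroot \<alpha> \<alpha>v \<gamma>) \<noteq> 0}"

text \<open>For a generalized Cartan matrix adjacency is symmetric, so reachability is an equivalence.\<close>

definition conn_components ::
    "('i \<Rightarrow> 'h::real_normed_vector \<Rightarrow>\<^sub>L real) \<Rightarrow> ('i \<Rightarrow> 'h) \<Rightarrow> ('h \<Rightarrow>\<^sub>L real) set
      \<Rightarrow> ('h \<Rightarrow>\<^sub>L real) set set" where
  "conn_components \<alpha> \<alpha>v K = K // (Restr (dynkin_adj \<alpha> \<alpha>v) K)\<^sup>*"

definition mu_connected ::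
    "('i \<Rightarrow> 'h::real_normed_vector \<Rightarrow>\<^sub>L real) \<Rightarrow> ('i \<Rightarrow> 'h) \<Rightarrow> ('h \<Rightarrow>\<^sub>L real)
      \<Rightarrow> ('h \<Rightarrow>\<^sub>L real) set \<Rightarrow> bool" where
  "mu_connected \<alpha> \<alpha>v \<mu> I \<longleftrightarrow>
     I \<subseteq> range \<alpha> \<and> (\<forall>C \<in> conn_components \<alpha> \<alpha>v I. \<not> C \<subseteq> J0 \<alpha> \<alpha>v \<mu>)"

text \<open>\<open>upper_star\<close> is \<open>K\<^sup>*\<close> and \<open>lower_star\<close> is \<open>I\<^sub>*\<close>; the order in \<open>upper_star\<close> is inclusion.\<close>

definition upper_star ::
    "('i \<Rightarrow> 'h::real_normed_vector \<Rightarrow>\<^sub>L real) \<Rightarrow> ('i \<Rightarrow> 'h) \<Rightarrow> ('h \<Rightarrow>\<^sub>L real)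
      \<Rightarrow> ('h \<Rightarrow>\<^sub>L real) set \<Rightarrow> ('h \<Rightarrow>\<^sub>L real) set" where
  "upper_star \<alpha> \<alpha>v \<mu> K = (GREATEST L. L \<subseteq> K \<and> mu_connected \<alpha> \<alpha>v \<mu> L)"

definition lower_star ::
    "('i \<Rightarrow> 'h::real_normed_vector \<Rightarrow>\<^sub>L real) \<Rightarrow> ('i \<Rightarrow> 'h) \<Rightarrow> ('h \<Rightarrow>\<^sub>L real)
      \<Rightarrow> ('h \<Rightarrow>\<^sub>L real) set \<Rightarrow> ('h \<Rightarrow>\<^sub>L real) set" where
  "lower_star \<alpha> \<alpha>v \<mu> I = {\<beta> \<in> J0 \<alpha> \<alpha>v \<mu> - I.
     \<forall>\<gamma> \<in> I. refl \<alpha> \<alpha>v \<beta> \<circ> refl \<alpha> \<alpha>v \<gamma> = refl \<alpha> \<alpha>v \<gamma> \<circ> refl \<alpha> \<alpha>v \<beta>}"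

definition orbit_hull ::
    "('i \<Rightarrow> 'h::real_normed_vector \<Rightarrow>\<^sub>L real) \<Rightarrow> ('i \<Rightarrow> 'h) \<Rightarrow> ('h \<Rightarrow>\<^sub>L real) \<Rightarrow> ('h \<Rightarrow>\<^sub>L real) set" where
  "orbit_hull \<alpha> \<alpha>v \<mu> = convex hull ((\<lambda>w. w \<mu>) ` weyl_group \<alpha> \<alpha>v)"

definition std_face ::
    "('i \<Rightarrow> 'h::real_normed_vector \<Rightarrow>\<^sub>L real) \<Rightarrow> ('i \<Rightarrow> 'h) \<Rightarrow> ('h \<Rightarrow>\<^sub>L real)
      \<Rightarrow> ('h \<Rightarrow>\<^sub>L real) set \<Rightarrow> ('h \<Rightarrow>\<^sub>L real) set" where
  "std_face \<alpha> \<alpha>v \<mu> I = convex hull ((\<lambda>w. w \<mu>) ` parabolic \<alpha> \<alpha>v I)"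

definition face_join :: "'v::real_vector set \<Rightarrow> 'v set \<Rightarrow> 'v set \<Rightarrow> 'v set" where
  "face_join H F F' = (LEAST G. G face_of H \<and> F \<subseteq> G \<and> F' \<subseteq> G)"

end

theory Submission imports Defs begin

text \<open>
  Everything rests on the positivity of roots and coroots: if \<open>w s\<^sub>i\<close> is not shorter than \<open>w\<close>, then \<open>w\<close>
  maps the \<open>i\<close>-th simple root and coroot to nonnegative combinations of simple ones. As the length
  depends only on the group, a single proof (the reduction of Deodhar and Humphreys to rank two) serves
  the action on the dual space and the one on the space itself.

  For dominant \<open>\<mu>\<close> it follows that \<open>\<mu> - w \<mu>\<close> is a nonnegative combination of simple roots and that it
  involves only roots from \<open>K\<close> exactly if \<open>w \<mu>\<close> lies in \<open>W\<^sub>K \<mu>\<close>. So the standard face of \<open>K\<close> consists of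
  the points \<open>x\<close> of the hull for which \<open>\<mu> - x\<close> is supported on \<open>K\<close>.

  For (a), a point \<open>x = w z\<close> of the intersection satisfies \<open>\<mu> - x = (\<mu> - w \<mu>) + w (\<mu> - z)\<close> with nonnegative
  summands. Both are therefore supported on \<open>I\<close>; since \<open>w\<close> has no left descent in \<open>I\<close>, this forces
  \<open>w \<mu> = \<mu>\<close>, and then the second summand is supported on the roots of \<open>I \<inter> w I'\<close>.

  For (b), let \<open>G\<close> be a face containing both given faces. It suffices that the directions of \<open>G\<close> contain
  the simple roots of \<open>I\<close>, \<open>I'\<close> and \<open>red w\<close>. The letters of a reduced word of \<open>w\<close> are absorbed into \<open>I\<close> one
  after the other: when \<open>s\<^sub>i\<close> is the first letter, there are points of \<open>G\<close> strictly on both sides of the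
  hyperplane of \<open>s\<^sub>i\<close>, and reflecting the segment between them yields a crossing segment, which the face
  \<open>G\<close> must contain as well.
\<close>

subsection \<open>Reflections given by a generalized Cartan matrix\<close>

text \<open>Covers the roots with the action on functionals as well as the coroots with the action
  on the space, where the matrix is transposed.\<close>

locale gcm_reflections =
  fixes e :: "'i::finite \<Rightarrow> 'v::real_vector" and f :: "'i \<Rightarrow> 'v \<Rightarrow> real" and a :: "'i \<Rightarrow> 'i \<Rightarrow> int"
  assumes f_linear: "linear (f i)"
    and f_e: "f i (e j) = of_int (a i j)"
    and a_diag: "a i i = 2"
    and a_off: "i \<noteq> j \<Longrightarrow> a i j \<le> 0"
    and a_zero: "a i j = 0 \<Longrightarrow> a j i = 0"
begin

section \<open>Words in the reflections and their length\<close>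

definition s :: "'i \<Rightarrow> 'v \<Rightarrow> 'v" where "s i x = x - f i x *\<^sub>R e i"

text \<open>Group elements are handled through words: the group is the range of \<open>act\<close>,
  and \<open>rev us\<close> represents the inverse of \<open>act us\<close>.\<close>

definition act :: "'i list \<Rightarrow> 'v \<Rightarrow> 'v" where "act us = foldr (\<circ>) (map s us) id"

definition L :: "('v \<Rightarrow> 'v) \<Rightarrow> nat" where "L w = (LEAST n. \<exists>us. act us = w \<and> length us = n)"

definition pcone :: "'v set" where
  "pcone = {x. \<exists>c. (\<forall>i. 0 \<le> c i) \<and> x = (\<Sum>i\<in>UNIV. c i *\<^sub>R e i)}"

lemma f_simps [simp]: "f i (x + y) = f i x + f i y" "f i (x - y) = f i x - f i y"
  "f i (c *\<^sub>R x) = c * f i x" "f i (- x) = - f i x" "f i 0 = 0"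
  using f_linear[of i] by (auto simp: linear_add linear_diff linear_cmul linear_neg linear_0)

lemma s_s [simp]: "s i (s i x) = x"
  by (simp add: s_def f_e a_diag algebra_simps)

lemma linear_s: "linear (s i)"
  unfolding s_def by (rule linearI) (auto simp: algebra_simps)

lemma act_Nil [simp]: "act [] = id" and act_Cons: "act (i # us) = s i \<circ> act us"
  by (auto simp: act_def)

lemma act_append: "act (us @ vs) = act us \<circ> act vs"
  by (induction us) (auto simp: act_Cons)

lemma linear_act: "linear (act us)"
proof (induction us)
  case Nil
  show ?case unfolding act_Nil by (rule linear_id)
next
  case (Cons i us)
  then show ?case unfolding act_Cons by (intro linear_compose linear_s)
qed

lemma act_simps [simp]: "act us (x + y) = act us x + act us y" "act us (x - y) = act us x - act us y"
  "act us (c *\<^sub>R x) = c *\<^sub>R act us x" "act us (- x) = - act us x" "act us 0 = 0"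
  using linear_act[of us] by (auto simp: linear_add linear_diff linear_cmul linear_neg linear_0)

lemma act_sum: "act us (sum h S) = (\<Sum>x\<in>S. act us (h x))"
  using linear_act[of us] by (simp add: linear_sum)

lemma act_rev_left [simp]: "act (rev us) (act us x) = x"
  by (induction us arbitrary: x) (auto simp: act_Cons act_append)

lemma act_rev_right [simp]: "act us (act (rev us) x) = x"
  using act_rev_left[of "rev us"] by simp

lemma act_rev_cong: "act us = act vs \<Longrightarrow> act (rev us) = act (rev vs)"
  by (metis act_rev_left act_rev_right ext)

lemma bij_act: "bij (act us)"
  by (rule bij_betw_byWitness[where f' = "act (rev us)"]) auto

lemma L_le: "L (act us) \<le> length us"
  unfolding L_def by (rule Least_le) blast

lemma reduced_ex: "\<exists>vs. act vs = act us \<and> length vs = L (act us)"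
  unfolding L_def by (rule LeastI_ex) blast

lemma L_append: "L (act (us @ vs)) \<le> L (act us) + length vs"
proof -
  obtain us' where "act us' = act us" "length us' = L (act us)" using reduced_ex by blast
  then show ?thesis using L_le[of "us' @ vs"] by (simp add: act_append)
qed

lemma L_rev: "L (act (rev us)) = L (act us)"
proof -
  have "L (act (rev us)) \<le> L (act us)" for us
  proof -
    obtain us' where "act us' = act us" "length us' = L (act us)" using reduced_ex by blast
    then show ?thesis using L_le[of "rev us'"] act_rev_cong[of us' us] by simp
  qed
  from this[of us] this[of "rev us"] show ?thesis by simp
qed

text \<open>A shorter word for one factor would shorten the whole word.\<close>

lemma reduced_appendD:
  assumes "L (act (us @ vs)) = length (us @ vs)"
  shows "L (act us) = length us" "L (act vs) = length vs"
proof -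
  show "L (act us) = length us"
    using L_append[of us vs] L_le[of us] assms by simp
  obtain vs' where "act vs' = act vs" "length vs' = L (act vs)" using reduced_ex by blast
  then show "L (act vs) = length vs"
    using L_le[of "us @ vs'"] L_le[of vs] assms by (simp add: act_append)
qed

text \<open>Among the length-additive factorizations with right factor in \<open>K\<close>, one with
  shortest \<open>p\<close> is taken. A letter of \<open>K\<close> that shortens \<open>p\<close>
  could be moved to \<open>q\<close>, so there is none. The minimality is exported because
  \<open>p\<close> is later compared with another left factor.\<close>

lemma coset_decomposition:
  obtains p q where "act (p @ q) = act us" "length p + length q = L (act us)" "set q \<subseteq> K"
    "\<And>k. k \<in> K \<Longrightarrow> L (act p) \<le> L (act (p @ [k]))"
    "\<And>p' q'. act (p' @ q') = act us \<Longrightarrow> length p' + length q' = L (act us) \<Longrightarrow> set q' \<subseteq> K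
       \<Longrightarrow> length p \<le> length p'"
proof -
  define P where "P p q \<longleftrightarrow> act (p @ q) = act us \<and> length p + length q = L (act us) \<and> set q \<subseteq> K" for p q
  have "\<exists>n p q. P p q \<and> length p = n"
    using reduced_ex[of us] unfolding P_def
    by (metis append_Nil2 empty_set empty_subsetI list.size(3) add.right_neutral)
  define n where "n = (LEAST n. \<exists>p q. P p q \<and> length p = n)"
  obtain p q where pq: "P p q" "length p = n"
    using LeastI_ex[OF \<open>\<exists>n p q. P p q \<and> length p = n\<close>] unfolding n_def by blast
  have min: "length p \<le> length p'" if "P p' q'" for p' q'
    unfolding pq(2) n_def by (rule Least_le) (use that in blast)
  show ?thesis
  proof (rule that[of p q])
    fix k assume k: "k \<in> K"
    show "L (act p) \<le> L (act (p @ [k]))"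
    proof (rule ccontr)
      assume "\<not> ?thesis"
      moreover obtain p' where p': "act p' = act (p @ [k])" "length p' = L (act (p @ [k]))"
        using reduced_ex by blast
      ultimately have less: "length p' < length p" using L_le[of p] by simp
      \<comment> \<open>\<open>p'\<close> represents \<open>p @ [k]\<close>, so the two copies of
        \<open>k\<close> cancel.\<close>
      have act: "act (p' @ k # q) = act us"
        using pq(1) p'(1) by (auto simp: P_def act_append act_Cons fun_eq_iff)
      have "L (act us) \<le> length p' + Suc (length q)"
        using L_le[of "p' @ k # q"] act by simp
      then have "P p' (k # q)"
        using less act pq(1) k by (auto simp: P_def)
      from min[OF this] less show False by simp
    qed
  qed (use pq min in \<open>auto simp: P_def\<close>)
qed

section \<open>Nonnegative combinations and the case of rank two\<close>

lemma pcone_add: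
  assumes "x \<in> pcone" "y \<in> pcone"
  shows "x + y \<in> pcone"
proof -
  obtain c d where "\<forall>i. 0 \<le> c i" "x = (\<Sum>i\<in>UNIV. c i *\<^sub>R e i)"
    "\<forall>i. 0 \<le> d i" "y = (\<Sum>i\<in>UNIV. d i *\<^sub>R e i)"
    using assms unfolding pcone_def by auto
  then show ?thesis unfolding pcone_def
    by (auto intro!: exI[of _ "\<lambda>i. c i + d i"] simp: scaleR_add_left sum.distrib)
qed

lemma pcone_scale:
  assumes "0 \<le> t" "x \<in> pcone"
  shows "t *\<^sub>R x \<in> pcone"
proof -
  obtain c where "\<forall>i. 0 \<le> c i" "x = (\<Sum>i\<in>UNIV. c i *\<^sub>R e i)"
    using assms unfolding pcone_def by auto
  then show ?thesis unfolding pcone_def using assms(1)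
    by (auto intro!: exI[of _ "\<lambda>i. t * c i"] simp: scaleR_sum_right)
qed

lemma pcone_e: "e i \<in> pcone"
  unfolding pcone_def
  by (auto intro!: exI[of _ "\<lambda>j. if j = i then 1 else 0"] simp: if_distrib[of "\<lambda>c. c *\<^sub>R _"] cong: if_cong)

lemma pcone_0: "0 \<in> pcone"
  using pcone_scale[OF _ pcone_e, of 0] by simp

lemma pcone_sum: "(\<And>x. x \<in> S \<Longrightarrow> h x \<in> pcone) \<Longrightarrow> sum h S \<in> pcone"
  by (induction S rule: infinite_finite_induct) (auto simp: pcone_0 pcone_add)

text \<open>The alternating word of length \<open>n\<close> in \<open>i\<close> and \<open>j\<close> whose last letter is \<open>j\<close>.\<close>
fun altw :: "'i \<Rightarrow> 'i \<Rightarrow> nat \<Rightarrow> 'i list" where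
  "altw i j 0 = []"
| "altw i j (Suc n) = (if even n then j else i) # altw i j n"

lemma length_altw [simp]: "length (altw i j n) = n"
  by (induction n) auto

lemma altw_numeral: "altw i j 2 = [i, j]" "altw i j 3 = [j, i, j]" "altw i j 4 = [i, j, i, j]"
  "altw i j 5 = [j, i, j, i, j]" "altw i j 6 = [i, j, i, j, i, j]"
proof -
  show 2: "altw i j 2 = [i, j]" by (simp add: numeral_2_eq_2)
  show "altw i j 3 = [j, i, j]" "altw i j 4 = [i, j, i, j]"
    "altw i j 5 = [j, i, j, i, j]" "altw i j 6 = [i, j, i, j, i, j]"
    using altw.simps(2)[of i j 2] altw.simps(2)[of i j 3] altw.simps(2)[of i j 4]
      altw.simps(2)[of i j 5] by (simp_all add: 2 del: altw.simps(2))
qed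

lemma altw_suffix: "\<exists>p. altw i j (m + n) = p @ altw i j n"
  by (induction m) auto

lemma last_altw: "last (altw i j (Suc n)) = j"
  by (induction n) auto

lemma altw_eqI:
  assumes "set q \<subseteq> {i, j}" "distinct_adj q" "q \<noteq> [] \<Longrightarrow> last q = j"
  shows "q = altw i j (length q)"
  using assms
proof (induction q)
  case (Cons x q)
  show ?case
  proof (cases q)
    case (Cons y r)
    then have "q = altw i j (length q)" using Cons.IH Cons.prems by (auto split: if_splits)
    then show ?thesis using Cons Cons.prems
      by (auto split: if_splits)
  qed (use Cons in auto)
qed auto

lemma reduced_distinct_adj:
  "L (act us) = length us \<Longrightarrow> distinct_adj us"
proof (induction us)
  case (Cons i us)
  have us: "L (act us) = length us" using reduced_appendD(2)[of "[i]" us] Cons.prems by simp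
  show ?case
  proof (cases us)
    case (Cons j vs)
    have "i \<noteq> j"
    proof
      assume "i = j"
      then have "act (i # us) = act vs" by (auto simp: Cons act_Cons)
      then show False using L_le[of vs] Cons.prems Cons by simp
    qed
    then show ?thesis using Cons.IH[OF us] Cons by simp
  qed simp
qed simp

text \<open>Only meaningful if \<open>a i j * a j i < 4\<close>; otherwise the value 6 is junk.\<close>
definition coxeter_number :: "'i \<Rightarrow> 'i \<Rightarrow> nat" where
  "coxeter_number i j = (if a i j * a j i = 0 then 2 else if a i j * a j i = 1 then 3
     else if a i j * a j i = 2 then 4 else 6)"

text \<open>If the entries are nonzero, their negatives are at least 1 and at most their product,
  hence at most 3. The cases are the types A1 x A1, A2, B2 and G2.\<close>

lemma rank_two_cases:
  assumes "i \<noteq> j" "a i j * a j i < 4"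
  shows "(a i j = 0 \<and> a j i = 0) \<or> (a i j = -1 \<and> a j i = -1) \<or> (a i j = -1 \<and> a j i = -2)
    \<or> (a i j = -2 \<and> a j i = -1) \<or> (a i j = -1 \<and> a j i = -3) \<or> (a i j = -3 \<and> a j i = -1)"
proof (cases "a i j = 0")
  case False
  define p q where "p = - a i j" and "q = - a j i"
  have pq: "p \<ge> 1" "q \<ge> 1" "p * q < 4"
    using False a_off[of i j] a_off[of j i] a_zero[of j i] assms unfolding p_def q_def by fastforce+
  have "p \<le> p * q" "q \<le> p * q" using pq by (auto simp: mult_le_cancel_left1 mult_le_cancel_right1)
  then have "p = 1 \<or> p = 2 \<or> p = 3" "q = 1 \<or> q = 2 \<or> q = 3" using pq by linarith+
  moreover have "a i j = - p" "a j i = - q" by (simp_all add: p_def q_def)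
  ultimately show ?thesis using pq(3) by (elim disjE) simp_all
qed (use a_zero in auto)

text \<open>Both reflections change a vector only by multiples of \<open>e i\<close> and
  \<open>e j\<close>, so it suffices to follow the two coefficients added to \<open>x\<close> in
  each of the six cases.\<close>

lemma braid_relation:
  assumes ij: "i \<noteq> j" "a i j * a j i < 4"
  shows "act (altw i j (coxeter_number i j)) = act (altw j i (coxeter_number i j))"
proof
  fix x
  have s_i: "s i (x + (u *\<^sub>R e i + v *\<^sub>R e j)) = x + ((- f i x - u - of_int (a i j) * v) *\<^sub>R e i + v *\<^sub>R e j)" for u v
    by (simp add: s_def f_e a_diag algebra_simps flip: scaleR_2)
  have s_j: "s j (x + (u *\<^sub>R e i + v *\<^sub>R e j)) = x + (u *\<^sub>R e i + (- f j x - v - of_int (a j i) * u) *\<^sub>R e j)" for u v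
    by (simp add: s_def f_e a_diag algebra_simps flip: scaleR_2)
  have comb: "u = u' \<Longrightarrow> v = v' \<Longrightarrow> x + (u *\<^sub>R e i + v *\<^sub>R e j) = x + (u' *\<^sub>R e i + v' *\<^sub>R e j)" for u u' v v'
    by simp
  \<comment> \<open>The zero coefficients are written out so that \<open>s_i\<close> and
    \<open>s_j\<close> rewrite from the first letter on.\<close>
  have "act (altw i j (coxeter_number i j)) (x + (0 *\<^sub>R e i + 0 *\<^sub>R e j))
      = act (altw j i (coxeter_number i j)) (x + (0 *\<^sub>R e i + 0 *\<^sub>R e j))"
    using rank_two_cases[OF ij]
    apply (elim disjE conjE)
         apply (simp_all only: coxeter_number_def)
         apply (simp_all add: altw_numeral act_Cons del: scaleR_zero_left add_0_right)
         apply (simp_all only: s_i s_j)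
         apply (rule comb, (simp add: algebra_simps; fail), (simp add: algebra_simps; fail))+
    done
  then show "act (altw i j (coxeter_number i j)) x = act (altw j i (coxeter_number i j)) x"
    by simp
qed

lemma s_comb:
  "s i (x *\<^sub>R e i + y *\<^sub>R e j) = (- x - of_int (a i j) * y) *\<^sub>R e i + y *\<^sub>R e j"
  by (simp add: s_def f_e a_diag algebra_simps flip: scaleR_2)

text \<open>For a product below 4 only \<open>n\<close> up to 5 occurs and the coefficients are
  computed. Otherwise a bound on the ratio of the two coefficients persists for all
  \<open>n\<close>.\<close>

lemma rank_two_positive:
  assumes ij: "i \<noteq> j" and n: "a i j * a j i < 4 \<Longrightarrow> n < coxeter_number i j"
  shows "\<exists>x\<ge>0. \<exists>y\<ge>0. act (altw i j n) (e i) = x *\<^sub>R e i + y *\<^sub>R e j"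
proof (cases "a i j * a j i < 4")
  case True
  have s_j: "s j (x *\<^sub>R e i + y *\<^sub>R e j) = x *\<^sub>R e i + (- y - of_int (a j i) * x) *\<^sub>R e j" for x y :: real
    using s_comb[of j y x i] by (simp add: add.commute)
  have comb: "0 \<le> x \<Longrightarrow> 0 \<le> y \<Longrightarrow> \<exists>x'\<ge>0. \<exists>y'\<ge>0. x *\<^sub>R e i + y *\<^sub>R e j = x' *\<^sub>R e i + y' *\<^sub>R e j" for x y
    by blast
  have "n = 0 \<or> n = 1 \<or> n = 2 \<or> n = 3 \<or> n = 4 \<or> n = 5" "n < coxeter_number i j"
    using n[OF True] by (auto simp: coxeter_number_def split: if_splits)
  then have "\<exists>x'\<ge>0. \<exists>y'\<ge>0. act (altw i j n) (1 *\<^sub>R e i + 0 *\<^sub>R e j) = x' *\<^sub>R e i + y' *\<^sub>R e j"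
    using rank_two_cases[OF ij True]
    apply (elim disjE conjE)
    apply (simp_all only: coxeter_number_def)
    apply (simp_all add: altw_numeral act_Cons del: scaleR_zero_left scaleR_one add_0_right)
    apply (simp_all only: s_comb s_j)
    apply (rule comb, (simp; fail), (simp; fail))+
    done
  then show ?thesis by simp
next
  case False
  define p r where "p = - real_of_int (a i j)" and "r = - real_of_int (a j i)"
  have "p \<ge> 0" "r \<ge> 0" using a_off[OF ij] a_off[of j i] ij by (auto simp: p_def r_def)
  have "4 \<le> a i j * a j i" using False by simp
  then have pr: "4 \<le> p * r" unfolding p_def r_def
    by (metis mult_minus_left mult_minus_right minus_minus of_int_le_iff of_int_mult of_int_numeral)
  \<comment> \<open>The next reflection replaces \<open>y\<close> by \<open>r * x - y\<close> for
    even \<open>n\<close> and \<open>x\<close> by \<open>p * y - x\<close> for odd \<open>n\<close>.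
    The bound keeps the new coefficient nonnegative, and \<open>4 \<le> p * r\<close> yields the
    bound for the other parity.\<close>
  have "\<exists>x\<ge>0. \<exists>y\<ge>0. act (altw i j n) (e i) = x *\<^sub>R e i + y *\<^sub>R e j \<and>
      (if even n then 2 * y \<le> r * x else 2 * x \<le> p * y)"
  proof (induction n)
    case 0
    show ?case using \<open>r \<ge> 0\<close> by (intro exI[of _ 1] conjI exI[of _ 0]) auto
  next
    case (Suc n)
    then obtain x y where xy: "0 \<le> x" "0 \<le> y" "act (altw i j n) (e i) = x *\<^sub>R e i + y *\<^sub>R e j"
      and bound: "if even n then 2 * y \<le> r * x else 2 * x \<le> p * y" by blast
    show ?case
    proof (cases "even n")
      case True
      have "p * (2 * y) \<le> p * (r * x)" using bound True \<open>p \<ge> 0\<close> by (simp add: mult_left_mono)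
      moreover have "4 * x \<le> p * r * x" using pr xy(1) by (rule mult_right_mono)
      ultimately have "2 * x \<le> p * (r * x - y)" by (simp add: algebra_simps)
      moreover have "act (altw i j (Suc n)) (e i) = x *\<^sub>R e i + (r * x - y) *\<^sub>R e j"
        using True xy(3) s_comb[of j y x i] by (simp add: act_Cons r_def add.commute)
      moreover have "0 \<le> r * x - y" using True bound xy by simp
      ultimately show ?thesis using True xy(1)
        by (intro exI[of _ x] conjI exI[of _ "r * x - y"]) auto
    next
      case False
      have "r * (2 * x) \<le> r * (p * y)" using bound False \<open>r \<ge> 0\<close> by (simp add: mult_left_mono)
      moreover have "4 * y \<le> p * r * y" using pr xy(2) by (rule mult_right_mono)
      ultimately have "2 * y \<le> r * (p * y - x)" by (simp add: algebra_simps)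
      moreover have "act (altw i j (Suc n)) (e i) = (p * y - x) *\<^sub>R e i + y *\<^sub>R e j"
        using False xy(3) s_comb[of i x y j] by (simp add: act_Cons p_def)
      moreover have "0 \<le> p * y - x" using False bound xy by simp
      ultimately show ?thesis using False xy(2)
        by (intro exI[of _ "p * y - x"] conjI exI[of _ y]) auto
    qed
  qed
  then show ?thesis by blast
qed

text \<open>Induction on the length. With \<open>j\<close> the last letter of a reduced word, a
  right factor \<open>q\<close> in the letters \<open>i\<close> and \<open>j\<close> is split off.
  The remaining \<open>p\<close> is shorter and sends \<open>e i\<close> and \<open>e j\<close> into
  the cone by induction, while \<open>q\<close> sends \<open>e i\<close> to a nonnegative
  combination of these two.\<close>

theorem length_increasing_positive:
  assumes "L (act us) \<le> L (act (us @ [i]))"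
  shows "act us (e i) \<in> pcone"
  using assms
proof (induction "L (act us)" arbitrary: us i rule: less_induct)
  case less
  obtain us' where us': "act us' = act us" "length us' = L (act us)" using reduced_ex by blast
  show ?case
  proof (cases us' rule: rev_cases)
    case Nil
    then show ?thesis using us'(1) by (simp add: pcone_e flip: us'(1))
  next
    case (snoc vs j)
    obtain p q where act_pq: "act (p @ q) = act us" and len_pq: "length p + length q = L (act us)"
      and q: "set q \<subseteq> {i, j}" and p: "\<And>k. k \<in> {i, j} \<Longrightarrow> L (act p) \<le> L (act (p @ [k]))"
      and min: "\<And>p' q'. act (p' @ q') = act us \<Longrightarrow> length p' + length q' = L (act us) \<Longrightarrow> set q' \<subseteq> {i, j}
       \<Longrightarrow> length p \<le> length p'"
      using coset_decomposition[of us "{i, j}"] by blast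
    \<comment> \<open>The factorization into \<open>vs\<close> and \<open>[j]\<close> competes with
      \<open>p\<close> and \<open>q\<close>, so \<open>p\<close> is strictly shorter than the whole
      word.\<close>
    have "length p \<le> length vs"
      by (rule min[of vs "[j]"]) (use us' snoc in auto)
    then have "length p < L (act us)" using us'(2) snoc by simp
    then have small: "L (act p) < L (act us)" using L_le[of p] by simp
    have p_e: "act p (e i) \<in> pcone" "act p (e j) \<in> pcone"
      using less.hyps[OF small] p by auto
    \<comment> \<open>A word for \<open>q\<close> of the same length ending in \<open>i\<close>
      would make \<open>us @ [i]\<close> shorter than \<open>us\<close>.\<close>
    have no_i: "last q' \<noteq> i" if "act q' = act q" "length q' = length q" "q' \<noteq> []" for q'
    proof
      assume "last q' = i"
      then obtain r where r: "q' = r @ [i]" using \<open>q' \<noteq> []\<close> by (metis append_butlast_last_id)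
      have "act (us @ [i]) = act (p @ r)"
        using act_pq that(1) by (auto simp: act_append act_Cons r fun_eq_iff) (metis s_s)
      then have "L (act (us @ [i])) \<le> length p + length r"
        using L_le[of "p @ r"] by simp
      then show False using that(2) r len_pq less.prems by simp
    qed
    have "i \<noteq> j"
    proof
      assume "i = j"
      then have "act (us @ [i]) = act vs" using us'(1) snoc by (auto simp: act_append act_Cons fun_eq_iff) (metis s_s)
      then show False using L_le[of vs] less.prems us' snoc by simp
    qed
    have "L (act (p @ q)) = length (p @ q)" using act_pq len_pq by simp
    then have "distinct_adj q" by (meson reduced_appendD(2) reduced_distinct_adj)
    moreover have "last q = j" if "q \<noteq> []"
      using no_i[of q] that q last_in_set[OF that] by blast
    ultimately have q_eq: "q = altw i j (length q)" using q by (intro altw_eqI) auto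
    \<comment> \<open>Otherwise the braid relation rewrites the end of \<open>q\<close> into an
      alternating word that ends in \<open>i\<close>.\<close>
    have "length q < coxeter_number i j" if fin: "a i j * a j i < 4"
    proof (rule ccontr)
      assume "\<not> ?thesis"
      then obtain m where m: "length q = m + coxeter_number i j"
        by (metis le_Suc_ex add.commute not_less)
      obtain r where r: "altw i j (length q) = r @ altw i j (coxeter_number i j)"
        using altw_suffix[of i j m] m by metis
      have "act (r @ altw j i (coxeter_number i j)) = act q"
        by (subst q_eq, subst r) (simp add: act_append braid_relation[OF \<open>i \<noteq> j\<close> fin])
      moreover have "length (r @ altw j i (coxeter_number i j)) = length q"
        using arg_cong[OF r, of length] by simp
      moreover obtain k where "coxeter_number i j = Suc k"
        using not0_implies_Suc[of "coxeter_number i j"] by (fastforce simp: coxeter_number_def)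
      ultimately show False
        using no_i[of "r @ altw j i (coxeter_number i j)"] last_altw[of j i k] by simp
    qed
    from rank_two_positive[OF \<open>i \<noteq> j\<close> this]
    obtain x y where "0 \<le> x" "0 \<le> y" "act q (e i) = x *\<^sub>R e i + y *\<^sub>R e j"
      using q_eq by auto
    moreover have "act us (e i) = act p (act q (e i))"
      using fun_cong[OF act_pq, of "e i"] by (simp add: act_append)
    ultimately show ?thesis
      using p_e by (simp add: pcone_add pcone_scale)
  qed
qed

text \<open>The theorem is applied to \<open>us @ [i]\<close>, as \<open>s i\<close> negates
  \<open>e i\<close>. Both hypotheses are non-strict, so one of the two results is available for any
  \<open>us\<close> and \<open>i\<close>.\<close>

corollary length_decreasing_negative:
  assumes "L (act (us @ [i])) \<le> L (act us)"
  shows "- act us (e i) \<in> pcone"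
proof -
  have eq: "act ((us @ [i]) @ [i]) = act us"
    by (simp add: act_append act_Cons fun_eq_iff)
  have "act (us @ [i]) (e i) \<in> pcone"
    by (rule length_increasing_positive) (simp only: eq assms)
  then show ?thesis by (simp add: act_append act_Cons s_def f_e a_diag scaleR_2)
qed

end

subsection \<open>The Weyl group of a realization\<close>

text \<open>The component of \<open>v j\<close> orthogonal to the span of the other vectors,
  rescaled, pairs to 1 with \<open>v j\<close> and to 0 with the others.\<close>

lemma dual_basis_exists:
  fixes v :: "'i \<Rightarrow> 'h::euclidean_space"
  assumes "inj v" "independent (range v)"
  obtains z where "\<And>i j. v i \<bullet> z j = (if i = j then 1 else 0)"
proof -
  have "\<exists>z. \<forall>i. v i \<bullet> z = (if i = j then 1 else 0)" for j
  proof -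
    have notin: "v j \<notin> span (v ` (- {j}))"
    proof -
      have "v ` (- {j}) = range v - {v j}" using assms(1) by (auto simp: inj_eq)
      then show ?thesis using assms(2) unfolding dependent_def by auto
    qed
    obtain y z where y: "y \<in> span (v ` (- {j}))" and z: "\<And>w. w \<in> span (v ` (- {j})) \<Longrightarrow> orthogonal z w"
      and v_j: "v j = y + z"
      using orthogonal_subspace_decomp_exists[of "v ` (- {j})" "v j"] by blast
    have "z \<noteq> 0" using y v_j notin by auto
    have "v j \<bullet> z = z \<bullet> z" using z[OF y] by (simp add: v_j inner_add_left inner_add_right orthogonal_def inner_commute)
    moreover have "v i \<bullet> z = 0" if "i \<noteq> j" for i
      using z[of "v i"] that by (auto simp: orthogonal_def inner_commute intro: span_base)
    ultimately show ?thesis using \<open>z \<noteq> 0\<close>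
      by (intro exI[of _ "(1 / (z \<bullet> z)) *\<^sub>R z"]) auto
  qed
  then show ?thesis using that by metis
qed

locale weyl_realization =
  fixes A :: "int^'i^'i" and \<alpha> :: "'i::finite \<Rightarrow> 'h::euclidean_space \<Rightarrow>\<^sub>L real" and \<alpha>v :: "'i \<Rightarrow> 'h"
  assumes gcm: "generalized_cartan_matrix A" and realization: "realization A \<alpha> \<alpha>v"
begin

lemma \<alpha>_\<alpha>v: "blinfun_apply (\<alpha> j) (\<alpha>v i) = real_of_int (A $ i $ j)"
  using realization unfolding realization_def by blast

lemma inj_\<alpha>: "inj \<alpha>"
  using realization unfolding realization_def by blast

text \<open>\<open>R\<close> is the action on functionals, with the simple roots in the role of
  \<open>e\<close>. Its counterpart \<open>C\<close> is the action on the space, with the coroots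
  and the transposed matrix.\<close>

sublocale R: gcm_reflections \<alpha> "\<lambda>i \<eta>. blinfun_apply \<eta> (\<alpha>v i)" "\<lambda>i j. A $ i $ j"
  using gcm unfolding generalized_cartan_matrix_def
  by unfold_locales (auto simp: \<alpha>_\<alpha>v linear_iff blinfun.bilinear_simps)

sublocale C: gcm_reflections \<alpha>v "\<lambda>i. blinfun_apply (\<alpha> i)" "\<lambda>i j. A $ j $ i"
  using gcm unfolding generalized_cartan_matrix_def
  by unfold_locales (auto simp: \<alpha>_\<alpha>v linear_iff blinfun.bilinear_simps)

abbreviation "act \<equiv> R.act"
abbreviation "coact \<equiv> C.act"

lemma fundamental_coweights:
  obtains \<omega> where "\<And>i j. blinfun_apply (\<alpha> i) (\<omega> j) = (if i = j then 1 else 0)"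
proof -
  \<comment> \<open>\<open>T \<eta>\<close> represents \<open>\<eta>\<close> by the inner product,
    so the dual vectors can be found in the space itself.\<close>
  define T :: "('h \<Rightarrow>\<^sub>L real) \<Rightarrow> 'h" where "T \<eta> = (\<Sum>b\<in>Basis. blinfun_apply \<eta> b *\<^sub>R b)" for \<eta>
  have T: "blinfun_apply \<eta> x = T \<eta> \<bullet> x" for \<eta> x
  proof -
    have "blinfun_apply \<eta> x = blinfun_apply \<eta> (\<Sum>b\<in>Basis. (x \<bullet> b) *\<^sub>R b)"
      by (simp add: euclidean_representation)
    also have "\<dots> = T \<eta> \<bullet> x"
      by (simp add: T_def blinfun.sum_right blinfun.scaleR_right inner_sum_left inner_commute[of x] mult.commute)
    finally show ?thesis .
  qed
  have "linear T"
    by (rule linearI) (simp_all add: T_def blinfun.bilinear_simps scaleR_add_left sum.distrib scaleR_sum_right)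
  moreover have "inj T"
    by (rule injI) (metis T blinfun_eqI)
  ultimately have "independent (range (T \<circ> \<alpha>))"
    using realization linear_independent_injective_image[of T "range \<alpha>"]
    unfolding realization_def by (simp add: image_comp inj_on_subset)
  moreover have "inj (T \<circ> \<alpha>)" using \<open>inj T\<close> inj_\<alpha> by (rule inj_compose)
  ultimately obtain \<omega> where "\<And>i j. (T \<circ> \<alpha>) i \<bullet> \<omega> j = (if i = j then 1 else 0)"
    using dual_basis_exists[of "T \<circ> \<alpha>"] by blast
  then show ?thesis using that[of \<omega>] T by simp
qed

lemma fundamental_weights:
  obtains \<phi> :: "'i \<Rightarrow> 'h \<Rightarrow>\<^sub>L real" where "\<And>i j. blinfun_apply (\<phi> j) (\<alpha>v i) = (if i = j then 1 else 0)"
proof -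
  obtain z where "\<And>i j. \<alpha>v i \<bullet> z j = (if i = j then 1 else 0)"
    using dual_basis_exists[of \<alpha>v] realization unfolding realization_def by blast
  then show ?thesis using that[of "\<lambda>j. blinfun_inner_left (z j)"] by (simp add: inner_commute)
qed

text \<open>Fundamental coweights: evaluation at \<open>\<omega> i\<close> reads off the coefficient
  of \<open>\<alpha> i\<close> in a combination of simple roots.\<close>

definition \<omega> :: "'i \<Rightarrow> 'h" where
  "\<omega> = (SOME \<omega>. \<forall>i j. blinfun_apply (\<alpha> i) (\<omega> j) = (if i = j then 1 else 0))"

lemma \<alpha>_\<omega> [simp]: "blinfun_apply (\<alpha> i) (\<omega> j) = (if i = j then 1 else 0)"
proof -
  have "\<exists>\<omega>. \<forall>i j. blinfun_apply (\<alpha> i) (\<omega> j) = (if i = j then 1 else 0)"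
    using fundamental_coweights by blast
  then have "\<forall>i j. blinfun_apply (\<alpha> i) (\<omega> j) = (if i = j then 1 else 0)"
    unfolding \<omega>_def by (rule someI_ex)
  then show ?thesis by simp
qed

lemma pcone_expand: "x \<in> R.pcone \<Longrightarrow> x = (\<Sum>i\<in>UNIV. blinfun_apply x (\<omega> i) *\<^sub>R \<alpha> i)"
  by (auto simp: R.pcone_def blinfun.sum_left blinfun.scaleR_left if_distrib cong: if_cong)

lemma pcone_nonneg: "x \<in> R.pcone \<Longrightarrow> 0 \<le> blinfun_apply x (\<omega> i)"
  by (auto simp: R.pcone_def blinfun.sum_left blinfun.scaleR_left if_distrib cong: if_cong)

lemma pcone_antisym: "x \<in> R.pcone \<Longrightarrow> - x \<in> R.pcone \<Longrightarrow> x = 0"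
proof -
  assume "x \<in> R.pcone" "- x \<in> R.pcone"
  then have "blinfun_apply x (\<omega> i) = 0" for i
    using pcone_nonneg[of x i] pcone_nonneg[of "- x" i] by (simp add: blinfun.minus_left)
  then show "x = 0" using pcone_expand[OF \<open>x \<in> R.pcone\<close>] by simp
qed

text \<open>A fundamental weight reads off the coefficient of \<open>\<alpha>v i\<close>, which
  would have to be -1.\<close>

lemma neg_coroot_notin: "- \<alpha>v i \<notin> C.pcone"
proof
  assume "- \<alpha>v i \<in> C.pcone"
  then obtain c where c: "\<forall>j. 0 \<le> c j" "- \<alpha>v i = (\<Sum>j\<in>UNIV. c j *\<^sub>R \<alpha>v j)" by (auto simp: C.pcone_def)
  obtain \<phi> :: "'i \<Rightarrow> 'h \<Rightarrow>\<^sub>L real"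
    where \<phi>: "\<And>i j. blinfun_apply (\<phi> j) (\<alpha>v i) = (if i = j then 1 else 0)"
    using fundamental_weights by blast
  have "blinfun_apply (\<phi> i) (- \<alpha>v i) = c i"
    unfolding c(2) by (simp add: blinfun.sum_right blinfun.scaleR_right \<phi> if_distrib cong: if_cong)
  then have "c i = -1" by (simp add: blinfun.minus_right \<phi>)
  then show False using c(1)[rule_format, of i] by simp
qed

lemma s_pair: "blinfun_apply (R.s i \<eta>) x = blinfun_apply \<eta> (C.s i x)"
  by (simp add: R.s_def C.s_def blinfun.bilinear_simps)

lemma act_pair: "blinfun_apply (act us \<eta>) x = blinfun_apply \<eta> (coact (rev us) x)"
  by (induction us arbitrary: x) (auto simp: R.act_Cons C.act_Cons C.act_append s_pair)

lemma act_pair': "blinfun_apply (act us \<eta>) (coact us x) = blinfun_apply \<eta> x"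
  by (simp add: act_pair)

text \<open>The two actions are contragredient, and points and functionals separate each other. So
  both actions have the same relations and hence the same length.\<close>

lemma act_eq_iff: "act us = act vs \<longleftrightarrow> coact us = coact vs"
proof
  assume "act us = act vs"
  have "coact (rev us) x = coact (rev vs) x" for x
  proof -
    have "blinfun_apply \<eta> (coact (rev us) x) = blinfun_apply \<eta> (coact (rev vs) x)" for \<eta> :: "'h \<Rightarrow>\<^sub>L real"
      using act_pair[of us \<eta> x] act_pair[of vs \<eta> x] \<open>act us = act vs\<close> by simp
    \<comment> \<open>Pairing the difference with itself shows that it vanishes.\<close>
    from this[of "blinfun_inner_left (coact (rev us) x - coact (rev vs) x)"]
    have "(coact (rev us) x - coact (rev vs) x) \<bullet> (coact (rev us) x - coact (rev vs) x) = 0"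
      unfolding blinfun_inner_left.rep_eq inner_diff_left[of _ _ "coact (rev us) x - coact (rev vs) x"]
      by (simp add: inner_commute)
    then show ?thesis by simp
  qed
  then show "coact us = coact vs" using C.act_rev_cong[of "rev us" "rev vs"] by fastforce
next
  assume "coact us = coact vs"
  then have "coact (rev us) = coact (rev vs)" by (rule C.act_rev_cong)
  then show "act us = act vs" by (auto intro!: blinfun_eqI simp: act_pair)
qed

lemma L_coact: "C.L (coact us) = R.L (act us)"
  unfolding C.L_def R.L_def act_eq_iff ..

lemma coroot_positive:
  assumes "R.L (act us) \<le> R.L (act (us @ [i]))"
  shows "coact us (\<alpha>v i) \<in> C.pcone"
  using assms by (intro C.length_increasing_positive) (simp add: L_coact)

lemma coroot_negative:
  assumes "R.L (act (us @ [i])) \<le> R.L (act us)"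
  shows "- coact us (\<alpha>v i) \<in> C.pcone"
  using assms by (intro C.length_decreasing_negative) (simp add: L_coact)

text \<open>Passing to the inverse turns the left factor \<open>i\<close> into a right one and
  preserves lengths.\<close>

lemma coroot_positive_left:
  assumes "R.L (act us) \<le> R.L (act (i # us))"
  shows "coact (rev us) (\<alpha>v i) \<in> C.pcone"
  using assms R.L_rev[of us] R.L_rev[of "i # us"] by (intro coroot_positive) simp

lemma coroot_negative_left:
  assumes "R.L (act (i # us)) \<le> R.L (act us)"
  shows "- coact (rev us) (\<alpha>v i) \<in> C.pcone"
  using assms R.L_rev[of us] R.L_rev[of "i # us"] by (intro coroot_negative) simp

section \<open>Dominant functionals and their orbits\<close>

definition dominant :: "('h \<Rightarrow>\<^sub>L real) \<Rightarrow> bool" where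
  "dominant \<nu> \<longleftrightarrow> (\<forall>i. 0 \<le> blinfun_apply \<nu> (\<alpha>v i))"

lemma dominant_pcone: "dominant \<nu> \<Longrightarrow> x \<in> C.pcone \<Longrightarrow> 0 \<le> blinfun_apply \<nu> x"
  by (auto simp: dominant_def C.pcone_def blinfun.sum_right blinfun.scaleR_right intro!: sum_nonneg)

lemma reduced_ConsD:
  assumes "R.L (act (i # us)) = length (i # us)"
  shows "R.L (act us) = length us" "R.L (act us) \<le> R.L (act (i # us))"
  using R.reduced_appendD(2)[of "[i]" us] assms by simp_all

text \<open>Along a reduced word every letter \<open>i\<close> subtracts a multiple of
  \<open>\<alpha> i\<close>. The factor is the value of \<open>\<nu>\<close> at a positive coroot,
  hence nonnegative.\<close>

lemma below_dominant:
  assumes "dominant \<nu>"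
  shows "\<nu> - act us \<nu> \<in> R.pcone"
proof -
  have red: "\<nu> - act us \<nu> \<in> R.pcone" if "R.L (act us) = length us" for us
    using that
  proof (induction us)
    case Nil
    then show ?case by (simp add: R.pcone_0)
  next
    case (Cons i us)
    note us = reduced_ConsD[OF Cons.prems]
    have "0 \<le> blinfun_apply (act us \<nu>) (\<alpha>v i)"
      using dominant_pcone[OF assms coroot_positive_left[OF us(2)]] by (simp add: act_pair)
    then have "(\<nu> - act us \<nu>) + blinfun_apply (act us \<nu>) (\<alpha>v i) *\<^sub>R \<alpha> i \<in> R.pcone"
      by (intro R.pcone_add Cons.IH us R.pcone_scale R.pcone_e)
    then show ?case by (simp add: R.act_Cons R.s_def algebra_simps)
  qed
  obtain vs where "act vs = act us" "length vs = R.L (act us)" using R.reduced_ex by blast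
  then show ?thesis using red[of vs] by simp
qed

text \<open>As the coweights read off coefficients, an \<open>x\<close> in the span of the simple
  roots with this property involves only the roots of \<open>K\<close>.\<close>

definition supp :: "('h \<Rightarrow>\<^sub>L real) \<Rightarrow> 'i set \<Rightarrow> bool" where
  "supp x K \<longleftrightarrow> (\<forall>i. i \<notin> K \<longrightarrow> blinfun_apply x (\<omega> i) = 0)"

text \<open>Nonnegative coefficients cannot cancel.\<close>

lemma supp_addD:
  assumes "supp (x + y) K" "x \<in> R.pcone" "y \<in> R.pcone"
  shows "supp x K" "supp y K"
proof -
  have "blinfun_apply x (\<omega> i) = 0 \<and> blinfun_apply y (\<omega> i) = 0" if "i \<notin> K" for i
    using assms(1) that pcone_nonneg[OF assms(2), of i] pcone_nonneg[OF assms(3), of i]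
    by (auto simp: supp_def blinfun.add_left)
  then show "supp x K" "supp y K" unfolding supp_def by auto
qed

lemma supp_act: "set us \<subseteq> K \<Longrightarrow> supp (\<nu> - act us \<nu>) K"
  by (induction us) (auto simp: supp_def R.act_Cons R.s_def blinfun.bilinear_simps)

text \<open>In a shortest word for \<open>\<eta>\<close> in the orbit of \<open>\<nu>\<close> the first letter strictly lowers, so it
  belongs to the support of \<open>\<nu> - \<eta>\<close>.\<close>
lemma orbit_supp:
  assumes "dominant \<nu>" "supp (\<nu> - act us \<nu>) K"
  shows "\<exists>vs. set vs \<subseteq> K \<and> act vs \<nu> = act us \<nu> \<and>
    (vs \<noteq> [] \<longrightarrow> blinfun_apply (act us \<nu>) (\<alpha>v (hd vs)) < 0)"
  using assms(2)
proof (induction "length us" arbitrary: us rule: less_induct)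
  case less
  show ?case
  \<comment> \<open>If no shorter word reaches the same point, \<open>us\<close> is reduced and its
    first letter moves the point, so \<open>c\<close> is nonzero below.\<close>
  proof (cases "\<exists>vs. length vs < length us \<and> act vs \<nu> = act us \<nu>")
    case True
    then obtain vs where "length vs < length us" "act vs \<nu> = act us \<nu>" by blast
    then show ?thesis using less.hyps[of vs] less.prems by auto
  next
    case False
    show ?thesis
    proof (cases us)
      case Nil
      then show ?thesis by (intro exI[of _ "[]"]) auto
    next
      case (Cons i vs)
      have "R.L (act us) = length us"
        by (metis R.reduced_ex R.L_le False le_neq_implies_less)
      then have le: "R.L (act vs) \<le> R.L (act (i # vs))" using reduced_ConsD(2) Cons by simp
      define c where "c = blinfun_apply (act vs \<nu>) (\<alpha>v i)"
      have act_us: "act us \<nu> = act vs \<nu> - c *\<^sub>R \<alpha> i"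
        by (simp add: Cons R.act_Cons R.s_def c_def)
      have "0 \<le> c"
        using dominant_pcone[OF assms(1) coroot_positive_left[OF le]] by (simp add: act_pair c_def)
      moreover have "c \<noteq> 0"
      proof
        assume "c = 0"
        then have "act vs \<nu> = act us \<nu>" using act_us by simp
        then show False using False Cons by auto
      qed
      ultimately have "0 < c" by simp
      have "supp ((\<nu> - act vs \<nu>) + c *\<^sub>R \<alpha> i) K"
        using less.prems by (simp add: act_us algebra_simps)
      from supp_addD[OF this below_dominant[OF assms(1)] R.pcone_scale[OF \<open>0 \<le> c\<close> R.pcone_e]]
      have K: "supp (\<nu> - act vs \<nu>) K" "i \<in> K"
        using \<open>0 < c\<close> by (fastforce simp: supp_def blinfun.scaleR_left)+
      obtain vs' where vs': "set vs' \<subseteq> K" "act vs' \<nu> = act vs \<nu>"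
        using less.hyps[of vs] K(1) Cons by auto
      have "blinfun_apply (act us \<nu>) (\<alpha>v i) < 0"
        using \<open>0 < c\<close> by (simp add: act_us blinfun.bilinear_simps R.f_e R.a_diag flip: c_def)
      then show ?thesis
        using vs' K(2) by (intro exI[of _ "i # vs'"]) (auto simp: R.act_Cons Cons)
    qed
  qed
qed

text \<open>For a reduced word, \<open>\<nu> - act us \<nu>\<close> and the multiple of
  \<open>\<alpha> i\<close> subtracted by the first letter \<open>i\<close> are nonnegative with sum
  zero. Both vanish, so \<open>i\<close> fixes \<open>\<nu>\<close> and so does the rest of the
  word.\<close>

lemma stabilizer:
  assumes "dominant \<nu>" "act us \<nu> = \<nu>"
  shows "\<exists>vs. act vs = act us \<and> set vs \<subseteq> {i. blinfun_apply \<nu> (\<alpha>v i) = 0}"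
proof -
  have red: "set us \<subseteq> {i. blinfun_apply \<nu> (\<alpha>v i) = 0}" if "R.L (act us) = length us" "act us \<nu> = \<nu>" for us
    using that
  proof (induction us)
    case (Cons i us)
    note us = reduced_ConsD[OF Cons.prems(1)]
    define c where "c = blinfun_apply (act us \<nu>) (\<alpha>v i)"
    have "0 \<le> c"
      using dominant_pcone[OF assms(1) coroot_positive_left[OF us(2)]] by (simp add: act_pair c_def)
    have "supp ((\<nu> - act us \<nu>) + c *\<^sub>R \<alpha> i) {}"
      using Cons.prems(2) by (simp add: R.act_Cons R.s_def c_def supp_def algebra_simps)
    from supp_addD[OF this below_dominant[OF assms(1)] R.pcone_scale[OF \<open>0 \<le> c\<close> R.pcone_e]]
    have supp: "supp (\<nu> - act us \<nu>) {}" "supp (c *\<^sub>R \<alpha> i) {}" .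
    have "\<nu> - act us \<nu> = 0"
      by (subst pcone_expand[OF below_dominant[OF assms(1)]]) (use supp(1) in \<open>simp add: supp_def\<close>)
    then have "act us \<nu> = \<nu>" by simp
    moreover from supp(2) have "blinfun_apply (c *\<^sub>R \<alpha> i) (\<omega> i) = 0" unfolding supp_def by blast
    then have "c = 0" by (simp add: blinfun.scaleR_left)
    ultimately show ?case using Cons.IH us(1) by (auto simp: c_def)
  qed simp
  obtain vs where "act vs = act us" "length vs = R.L (act us)" using R.reduced_ex by blast
  then show ?thesis using red[of vs] assms(2) by auto
qed

end

subsection \<open>Standard faces of the orbit hull\<close>

text \<open>The open half space below \<open>m\<close> together with the hull of the level set is
  convex and contains \<open>S\<close>, hence the whole hull.\<close>

lemma convex_hull_level_set:
  fixes g :: "'v::real_vector \<Rightarrow> real"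
  assumes g: "linear g" and bound: "\<And>y. y \<in> S \<Longrightarrow> g y \<le> m" and x: "x \<in> convex hull S" "g x = m"
  shows "x \<in> convex hull {y \<in> S. g y = m}"
proof -
  let ?T = "convex hull {y \<in> S. g y = m}"
  have T: "g y = m" if "y \<in> ?T" for y
  proof -
    have "convex {y. g y = m}"
      using g unfolding convex_def
      by (auto simp: linear_add linear_cmul) (metis distrib_right mult_1)
    then have "?T \<subseteq> {y. g y = m}" by (intro hull_minimal) auto
    then show ?thesis using that by auto
  qed
  have "convex ({y. g y < m} \<union> ?T)"
  proof (rule convexI)
    fix y z and u v :: real
    assume y: "y \<in> {y. g y < m} \<union> ?T" and z: "z \<in> {y. g y < m} \<union> ?T" and uv: "0 \<le> u" "0 \<le> v" "u + v = 1"
    show "u *\<^sub>R y + v *\<^sub>R z \<in> {y. g y < m} \<union> ?T"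
    proof (cases "y \<in> ?T \<and> z \<in> ?T")
      case True
      then show ?thesis using convexD[OF convex_convex_hull, of y _ z u v] uv by auto
    next
      case False
      show ?thesis
      proof (cases "u = 0 \<or> v = 0")
        case True
        then show ?thesis using y z uv by auto
      next
        case uv': False
        have le: "g y \<le> m" "g z \<le> m" and "g y < m \<or> g z < m" using y z T False by (auto simp: less_imp_le)
        then have "u * (m - g y) + v * (m - g z) > 0"
          using uv uv' by (smt (verit) mult_nonneg_nonneg mult_pos_pos)
        moreover have "u * (m - g y) + v * (m - g z) = m - (u * g y + v * g z)"
          using uv(3) by (simp add: algebra_simps) (metis distrib_left mult_1_right)
        ultimately show ?thesis using g by (simp add: linear_add linear_cmul)
      qed
    qed
  qed
  moreover have "S \<subseteq> {y. g y < m} \<union> ?T"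
    using bound by (force intro: hull_inc)
  ultimately have "convex hull S \<subseteq> {y. g y < m} \<union> ?T" by (rule hull_minimal[rotated])
  then show ?thesis using x by auto
qed

text \<open>For a convex set \<open>G\<close>, the direction space of its affine hull.\<close>
definition dirs :: "'v::real_vector set \<Rightarrow> 'v set" where
  "dirs G = {t *\<^sub>R (a - b) | t a b. 0 \<le> t \<and> a \<in> G \<and> b \<in> G}"

lemma subspace_dirs:
  assumes "convex G" "G \<noteq> {}"
  shows "subspace (dirs G)"
proof (rule subspaceI)
  show "0 \<in> dirs G" using assms(2) unfolding dirs_def by fastforce
next
  fix x y assume "x \<in> dirs G" "y \<in> dirs G"
  then obtain t a b t' a' b' where x: "x = t *\<^sub>R (a - b)" "0 \<le> t" "a \<in> G" "b \<in> G"
    and y: "y = t' *\<^sub>R (a' - b')" "0 \<le> t'" "a' \<in> G" "b' \<in> G" unfolding dirs_def by blast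
  show "x + y \<in> dirs G"
  proof (cases "t + t' = 0")
    case True
    then have "x + y = 0 *\<^sub>R (a - b)" using x(1,2) y(1,2) by (simp add: add_nonneg_eq_0_iff)
    then show ?thesis using x unfolding dirs_def by blast
  next
    case False
    \<comment> \<open>With these weights the two differences combine into one multiple of a
      difference of points of \<open>G\<close>.\<close>
    define u v where "u = t / (t + t')" and "v = t' / (t + t')"
    have uv: "0 \<le> u" "0 \<le> v" "u + v = 1" "(t + t') * u = t" "(t + t') * v = t'"
      using False x y by (auto simp: u_def v_def simp flip: add_divide_distrib)
    have "x + y = (t + t') *\<^sub>R ((u *\<^sub>R a + v *\<^sub>R a') - (u *\<^sub>R b + v *\<^sub>R b'))"
      using uv by (simp add: x y scaleR_diff_right scaleR_add_right)
    moreover have "u *\<^sub>R a + v *\<^sub>R a' \<in> G" "u *\<^sub>R b + v *\<^sub>R b' \<in> G"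
      using convexD[OF assms(1)] x y uv by auto
    ultimately show ?thesis unfolding dirs_def using x y by (metis (mono_tags, lifting) add_nonneg_nonneg mem_Collect_eq)
  qed
next
  fix c x assume "x \<in> dirs G"
  then obtain t a b where x: "x = t *\<^sub>R (a - b)" "0 \<le> t" "a \<in> G" "b \<in> G" unfolding dirs_def by blast
  show "c *\<^sub>R x \<in> dirs G"
  proof (cases "0 \<le> c")
    case True
    then have "c *\<^sub>R x = (c * t) *\<^sub>R (a - b)" "0 \<le> c * t" using x by auto
    then show ?thesis using x unfolding dirs_def by blast
  next
    case False
    have "c *\<^sub>R x = ((- c) * t) *\<^sub>R (b - a)" by (simp add: x(1) algebra_simps)
    moreover have "0 \<le> (- c) * t" using x(2) False by (intro mult_nonneg_nonneg) auto
    ultimately show ?thesis using x(3,4) unfolding dirs_def by blast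
  qed
qed

text \<open>An equation \<open>x - g = t *\<^sub>R (a - b)\<close> means that, after normalization,
  a point between \<open>x\<close> and \<open>b\<close> is also a convex combination of
  \<open>g\<close> and \<open>a\<close>. It lies in \<open>G\<close>, so the face contains the
  endpoint \<open>x\<close>.\<close>

lemma face_of_dirs:
  assumes G: "G face_of H" and "g \<in> G" "x \<in> H" "x - g \<in> dirs G"
  shows "x \<in> G"
proof -
  obtain t a b where t: "x - g = t *\<^sub>R (a - b)" "0 \<le> t" "a \<in> G" "b \<in> G"
    using assms(4) unfolding dirs_def by blast
  define u where "u = t / (1 + t)"
  have u: "0 \<le> u" "u < 1" "1 - u = 1 / (1 + t)" using t(2) by (auto simp: u_def field_simps)
  have "(1 - u) *\<^sub>R x + u *\<^sub>R b = (1 / (1 + t)) *\<^sub>R (x + t *\<^sub>R b)"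
    unfolding u(3) by (simp add: u_def scaleR_add_right)
  also have "x + t *\<^sub>R b = g + t *\<^sub>R a" using t(1) by (simp add: algebra_simps)
  also have "(1 / (1 + t)) *\<^sub>R (g + t *\<^sub>R a) = (1 - u) *\<^sub>R g + u *\<^sub>R a"
    unfolding u(3) by (simp add: u_def scaleR_add_right)
  finally have eq: "(1 - u) *\<^sub>R x + u *\<^sub>R b = (1 - u) *\<^sub>R g + u *\<^sub>R a" .
  have "convex G" using G by (rule face_of_imp_convex)
  then have y: "(1 - u) *\<^sub>R x + u *\<^sub>R b \<in> G"
    unfolding eq using assms(2) t u by (intro convexD) auto
  show ?thesis
  \<comment> \<open>In these cases the point is not interior to the segment, but \<open>x\<close> is
    then \<open>b\<close> or the point itself.\<close>
  proof (cases "x = b \<or> u = 0")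
    case True
    then show ?thesis using t y by auto
  next
    case False
    then have "(1 - u) *\<^sub>R x + u *\<^sub>R b \<in> open_segment x b"
      using u(1,2) unfolding in_segment by (intro conjI exI[of _ u]) auto
    moreover have "b \<in> H" using t(4) G face_of_imp_subset by blast
    ultimately show ?thesis using G y assms(3) unfolding face_of_def by blast
  qed
qed

context weyl_realization
begin

section \<open>Orbits and standard faces in terms of index sets\<close>

definition orb :: "('h \<Rightarrow>\<^sub>L real) \<Rightarrow> 'i set \<Rightarrow> ('h \<Rightarrow>\<^sub>L real) set" where
  "orb \<mu> K = {act us \<mu> | us. set us \<subseteq> K}"

definition F :: "('h \<Rightarrow>\<^sub>L real) \<Rightarrow> 'i set \<Rightarrow> ('h \<Rightarrow>\<^sub>L real) set" where
  "F \<mu> K = convex hull orb \<mu> K"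

lemma orb_mono: "K \<subseteq> K' \<Longrightarrow> orb \<mu> K \<subseteq> orb \<mu> K'"
  unfolding orb_def by blast

lemma F_mono: "K \<subseteq> K' \<Longrightarrow> F \<mu> K \<subseteq> F \<mu> K'"
  unfolding F_def by (intro hull_mono orb_mono)

lemma orb_F: "set us \<subseteq> K \<Longrightarrow> act us \<mu> \<in> F \<mu> K"
  unfolding F_def orb_def by (intro hull_inc) blast

lemma act_F:
  assumes "set us \<subseteq> K"
  shows "act us ` F \<mu> K = F \<mu> K"
proof -
  have sub: "act us ` F \<mu> K \<subseteq> F \<mu> K" if "set us \<subseteq> K" for us
  proof -
    have "act us ` orb \<mu> K \<subseteq> orb \<mu> K"
      using that unfolding orb_def
      by clarsimp (metis R.act_append comp_apply le_sup_iff set_append)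
    then show ?thesis unfolding F_def convex_hull_linear_image[OF R.linear_act]
      by (rule hull_mono)
  qed
  have "x \<in> act us ` F \<mu> K" if "x \<in> F \<mu> K" for x
    using sub[of "rev us"] assms that by (intro image_eqI[of _ _ "act (rev us) x"]) auto
  then show ?thesis using sub[OF assms] by blast
qed

lemma act_H: "x \<in> F \<mu> UNIV \<Longrightarrow> act us x \<in> F \<mu> UNIV"
  using act_F[of us UNIV \<mu>] by auto

lemma s_H: "x \<in> F \<mu> UNIV \<Longrightarrow> R.s i x \<in> F \<mu> UNIV"
  using act_H[of x \<mu> "[i]"] by (simp add: R.act_Cons)

lemma F_below:
  assumes "dominant \<mu>" "x \<in> F \<mu> UNIV"
  shows "\<mu> - x \<in> R.pcone"
proof -
  have "convex {x. \<mu> - x \<in> R.pcone}"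
    unfolding convex_def
  proof (intro ballI allI impI)
    fix x y and u v :: real
    assume *: "x \<in> {x. \<mu> - x \<in> R.pcone}" "y \<in> {x. \<mu> - x \<in> R.pcone}" "0 \<le> u" "0 \<le> v" "u + v = 1"
    have "\<mu> - (u *\<^sub>R x + v *\<^sub>R y) = (u + v) *\<^sub>R \<mu> - (u *\<^sub>R x + v *\<^sub>R y)" using * by simp
    also have "\<dots> = u *\<^sub>R (\<mu> - x) + v *\<^sub>R (\<mu> - y)" by (simp add: algebra_simps)
    finally show "u *\<^sub>R x + v *\<^sub>R y \<in> {x. \<mu> - x \<in> R.pcone}"
      using * by (auto intro: R.pcone_add R.pcone_scale)
  qed
  then have "F \<mu> UNIV \<subseteq> {x. \<mu> - x \<in> R.pcone}"
    unfolding F_def by (intro hull_minimal) (auto simp: orb_def below_dominant[OF assms(1)])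
  then show ?thesis using assms(2) by auto
qed

lemma F_supp:
  assumes "x \<in> F \<mu> K"
  shows "supp (\<mu> - x) K"
proof -
  have "convex {x. supp (\<mu> - x) K}"
    unfolding convex_def
  proof (intro ballI allI impI)
    fix x y and u v :: real
    assume *: "x \<in> {x. supp (\<mu> - x) K}" "y \<in> {x. supp (\<mu> - x) K}" "0 \<le> u" "0 \<le> v" "u + v = 1"
    have "\<mu> - (u *\<^sub>R x + v *\<^sub>R y) = (u + v) *\<^sub>R \<mu> - (u *\<^sub>R x + v *\<^sub>R y)" using * by simp
    also have "\<dots> = u *\<^sub>R (\<mu> - x) + v *\<^sub>R (\<mu> - y)" by (simp add: algebra_simps)
    finally show "u *\<^sub>R x + v *\<^sub>R y \<in> {x. supp (\<mu> - x) K}"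
      using * by (auto simp: supp_def blinfun.add_left blinfun.scaleR_left)
  qed
  then have "F \<mu> K \<subseteq> {x. supp (\<mu> - x) K}"
    unfolding F_def by (intro hull_minimal) (auto simp: orb_def supp_act)
  then show ?thesis using assms by auto
qed

text \<open>On the orbit the sum of the coweights outside \<open>K\<close> is maximal at
  \<open>\<mu>\<close>, and by \<open>orbit_supp\<close> the maximum is attained only on
  \<open>orb \<mu> K\<close>. So \<open>convex_hull_level_set\<close> applies.\<close>

lemma F_eq:
  assumes "dominant \<mu>"
  shows "F \<mu> K = {x \<in> F \<mu> UNIV. supp (\<mu> - x) K}"
proof
  show "F \<mu> K \<subseteq> {x \<in> F \<mu> UNIV. supp (\<mu> - x) K}"
    using F_supp F_mono[of K UNIV \<mu>] by auto
  show "{x \<in> F \<mu> UNIV. supp (\<mu> - x) K} \<subseteq> F \<mu> K"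
  proof safe
    fix x assume x: "x \<in> F \<mu> UNIV" "supp (\<mu> - x) K"
    define g where "g y = blinfun_apply y (\<Sum>i\<in>-K. \<omega> i)" for y :: "'h \<Rightarrow>\<^sub>L real"
    have g_sum: "g \<mu> - g y = (\<Sum>i\<in>-K. blinfun_apply (\<mu> - y) (\<omega> i))" for y
      by (simp add: g_def blinfun.sum_right blinfun.diff_left sum_subtractf)
    have "linear g" by (rule linearI) (simp_all add: g_def blinfun.add_left blinfun.scaleR_left)
    moreover have "g y \<le> g \<mu>" if "y \<in> orb \<mu> UNIV" for y
    proof -
      have "0 \<le> g \<mu> - g y" unfolding g_sum
        using that below_dominant[OF assms] by (intro sum_nonneg pcone_nonneg) (auto simp: orb_def)
      then show ?thesis by simp
    qed
    moreover have "x \<in> convex hull orb \<mu> UNIV" using x by (simp add: F_def)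
    moreover have "g x = g \<mu>"
      using g_sum[of x] x(2) by (simp add: supp_def)
    ultimately have "x \<in> convex hull {y \<in> orb \<mu> UNIV. g y = g \<mu>}"
      by (rule convex_hull_level_set)
    moreover have "{y \<in> orb \<mu> UNIV. g y = g \<mu>} \<subseteq> orb \<mu> K"
    proof safe
      fix y assume y: "y \<in> orb \<mu> UNIV" "g y = g \<mu>"
      then obtain us where us: "y = act us \<mu>" unfolding orb_def by blast
      have "(\<Sum>i\<in>-K. blinfun_apply (\<mu> - y) (\<omega> i)) = 0" using g_sum[of y] y(2) by simp
      then have "\<forall>i\<in>-K. blinfun_apply (\<mu> - y) (\<omega> i) = 0"
        using pcone_nonneg[OF below_dominant[OF assms, of us]]
        by (subst (asm) sum_nonneg_eq_0_iff) (auto simp: us)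
      then have "supp (\<mu> - act us \<mu>) K" by (auto simp: supp_def us)
      from orbit_supp[OF assms this] obtain vs where "set vs \<subseteq> K" "act us \<mu> = act vs \<mu>" by force
      then show "y \<in> orb \<mu> K" unfolding orb_def us by blast
    qed
    ultimately show "x \<in> F \<mu> K" unfolding F_def using hull_mono by blast
  qed
qed

lemma supp_scaleD: "supp (c *\<^sub>R x) K \<Longrightarrow> c \<noteq> 0 \<Longrightarrow> supp x K"
  by (simp add: supp_def blinfun.scaleR_left)

text \<open>Both endpoints of a segment lie below \<open>\<mu>\<close>, so at an inner point neither
  contribution to the support can cancel.\<close>

lemma F_face:
  assumes "dominant \<mu>"
  shows "F \<mu> K face_of F \<mu> UNIV"
proof -
  have "a \<in> F \<mu> K \<and> b \<in> F \<mu> K"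
    if ab: "a \<in> F \<mu> UNIV" "b \<in> F \<mu> UNIV" and x: "x \<in> F \<mu> K" "x \<in> open_segment a b" for a b x
  proof -
    obtain u where u: "0 < u" "u < 1" "x = (1 - u) *\<^sub>R a + u *\<^sub>R b"
      using x(2) by (auto simp: in_segment)
    have "\<mu> - x = (1 - u) *\<^sub>R (\<mu> - a) + u *\<^sub>R (\<mu> - b)"
      unfolding u(3) by (simp add: algebra_simps)
    then have "supp ((1 - u) *\<^sub>R (\<mu> - a) + u *\<^sub>R (\<mu> - b)) K" using F_supp[OF x(1)] by simp
    moreover have "(1 - u) *\<^sub>R (\<mu> - a) \<in> R.pcone" "u *\<^sub>R (\<mu> - b) \<in> R.pcone"
      using u ab F_below[OF assms] by (auto intro!: R.pcone_scale)
    ultimately have "supp ((1 - u) *\<^sub>R (\<mu> - a)) K" "supp (u *\<^sub>R (\<mu> - b)) K"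
      by (rule supp_addD)+
    then show ?thesis using u ab by (auto simp: F_eq[OF assms, of K] dest!: supp_scaleD)
  qed
  moreover have "F \<mu> K \<subseteq> F \<mu> UNIV" by (rule F_mono) simp
  moreover have "convex (F \<mu> K)" by (simp add: F_def)
  ultimately show ?thesis unfolding face_of_def by blast
qed

lemma supp_expand:
  assumes "x \<in> R.pcone" "supp x K"
  shows "x = (\<Sum>i\<in>K. blinfun_apply x (\<omega> i) *\<^sub>R \<alpha> i)"
proof -
  have "x = (\<Sum>i\<in>UNIV. blinfun_apply x (\<omega> i) *\<^sub>R \<alpha> i)" using assms(1) by (rule pcone_expand)
  also have "\<dots> = (\<Sum>i\<in>K. blinfun_apply x (\<omega> i) *\<^sub>R \<alpha> i)"
    using assms(2) by (intro sum.mono_neutral_right) (auto simp: supp_def)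
  finally show ?thesis .
qed

text \<open>\<open>x - \<mu>\<close> is a combination of simple roots from \<open>K\<close>, hence a
  direction of \<open>G\<close>.\<close>

lemma face_contains_F:
  assumes "dominant \<mu>" "G face_of F \<mu> UNIV" "\<mu> \<in> G" "\<And>i. i \<in> K \<Longrightarrow> \<alpha> i \<in> dirs G"
  shows "F \<mu> K \<subseteq> G"
proof
  fix x assume x: "x \<in> F \<mu> K"
  have sub: "subspace (dirs G)"
    using assms(2,3) by (intro subspace_dirs) (auto intro: face_of_imp_convex)
  have x': "x \<in> F \<mu> UNIV" using x F_mono[of K UNIV \<mu>] by auto
  have "\<mu> - x = (\<Sum>i\<in>K. blinfun_apply (\<mu> - x) (\<omega> i) *\<^sub>R \<alpha> i)"
    using F_below[OF assms(1) x'] F_supp[OF x] by (rule supp_expand)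
  also have "\<dots> \<in> dirs G"
    using sub assms(4) by (intro subspace_sum subspace_scale) auto
  finally have "- (\<mu> - x) \<in> dirs G" using sub by (rule subspace_neg[rotated])
  then have "x - \<mu> \<in> dirs G" by simp
  then show "x \<in> G" by (rule face_of_dirs[OF assms(2,3) x'])
qed

text \<open>The segments from \<open>\<nu>\<close> to \<open>\<eta>\<close> and from \<open>s\<^sub>i \<nu>\<close> to \<open>s\<^sub>i \<eta>\<close> cross, so a face that
  contains one of them contains the other.\<close>
lemma face_exchange:
  assumes G: "G face_of F \<mu> UNIV" and "\<nu> \<in> G" "\<eta> \<in> G"
    and pos: "0 < blinfun_apply \<nu> (\<alpha>v i)" and neg: "blinfun_apply \<eta> (\<alpha>v i) < 0"
  shows "\<alpha> i \<in> dirs G"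
proof -
  define p c where "p = blinfun_apply \<nu> (\<alpha>v i)" and "c = - blinfun_apply \<eta> (\<alpha>v i)"
  have pc: "0 < p" "0 < c" using pos neg by (simp_all add: p_def c_def)
  have s: "R.s i \<nu> = \<nu> - p *\<^sub>R \<alpha> i" "R.s i \<eta> = \<eta> + c *\<^sub>R \<alpha> i" by (simp_all add: R.s_def p_def c_def)
  \<comment> \<open>The weight at which the segment meets the hyperplane fixed by
    \<open>R.s i\<close>.\<close>
  define u where "u = p / (p + c)"
  have u: "0 < u" "u < 1" using pc by (auto simp: u_def)
  have "u * c = (1 - u) * p" using pc by (simp add: u_def field_simps)
  then have "(1 - u) *\<^sub>R R.s i \<nu> + u *\<^sub>R R.s i \<eta> = (1 - u) *\<^sub>R \<nu> + u *\<^sub>R \<eta>"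
    by (simp add: s scaleR_add_right scaleR_diff_right)
  moreover have "(1 - u) *\<^sub>R \<nu> + u *\<^sub>R \<eta> \<in> G"
    using assms(2,3) u face_of_imp_convex[OF G] by (intro convexD) auto
  ultimately have "(1 - u) *\<^sub>R R.s i \<nu> + u *\<^sub>R R.s i \<eta> \<in> G" by simp
  moreover have "R.s i \<nu> \<noteq> R.s i \<eta>"
    using pos neg by (metis R.s_s less_asym)
  then have "(1 - u) *\<^sub>R R.s i \<nu> + u *\<^sub>R R.s i \<eta> \<in> open_segment (R.s i \<nu>) (R.s i \<eta>)"
    using u by (auto simp: in_segment)
  moreover have "R.s i \<nu> \<in> F \<mu> UNIV" "R.s i \<eta> \<in> F \<mu> UNIV"
    using assms(2,3) face_of_imp_subset[OF G] by (auto intro: s_H)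
  ultimately have "R.s i \<nu> \<in> G" using G unfolding face_of_def by blast
  moreover have "\<alpha> i = (1 / p) *\<^sub>R (\<nu> - R.s i \<nu>)" using pc by (simp add: s)
  ultimately show ?thesis unfolding dirs_def using assms(2) pc by (auto intro!: exI)
qed

lemma face_reflect:
  assumes G: "G face_of F \<mu> UNIV" and "x \<in> G" "\<alpha> i \<in> dirs G"
  shows "R.s i x \<in> G"
proof (rule face_of_dirs[OF G \<open>x \<in> G\<close>])
  show "R.s i x \<in> F \<mu> UNIV" using assms(2) face_of_imp_subset[OF G] by (auto intro: s_H)
  have "subspace (dirs G)" using assms(2) face_of_imp_convex[OF G] by (intro subspace_dirs) auto
  then have "(- blinfun_apply x (\<alpha>v i)) *\<^sub>R \<alpha> i \<in> dirs G" using assms(3) by (rule subspace_scale)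
  then show "R.s i x - x \<in> dirs G" by (simp add: R.s_def)
qed

section \<open>Connectedness and positivity on orbits\<close>

definition adj :: "'i set \<Rightarrow> ('i \<times> 'i) set" where
  "adj K = {(i, j). i \<in> K \<and> j \<in> K \<and> i \<noteq> j \<and> A $ i $ j \<noteq> 0}"

text \<open>States without components that every node of \<open>K\<close> reaches, inside
  \<open>K\<close>, a node whose root is outside \<open>J0\<close>.\<close>

definition mconn :: "('h \<Rightarrow>\<^sub>L real) \<Rightarrow> 'i set \<Rightarrow> bool" where
  "mconn \<mu> K \<longleftrightarrow> (\<forall>i\<in>K. \<exists>j. (i, j) \<in> (adj K)\<^sup>* \<and> blinfun_apply \<mu> (\<alpha>v j) \<noteq> 0)"

lemma adj_mono: "K \<subseteq> K' \<Longrightarrow> adj K \<subseteq> adj K'"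
  unfolding adj_def by blast

text \<open>If the coefficient at \<open>k\<close> is zero, reflecting in \<open>k\<close> turns it
  into \<open>c\<close>, to which \<open>i\<close> contributes positively and no node negatively. If
  it is positive, the empty word serves.\<close>

lemma enlarge_support:
  assumes d: "\<And>j. 0 \<le> d j" "0 < d i" and "i \<noteq> k" "A $ i $ k \<noteq> 0"
  shows "\<exists>d' us. (\<forall>j. 0 \<le> d' j) \<and> 0 < d' k \<and> set us \<subseteq> {k} \<and>
    (\<Sum>j\<in>UNIV. d' j *\<^sub>R \<alpha>v j) = coact us (\<Sum>j\<in>UNIV. d j *\<^sub>R \<alpha>v j)"
proof (cases "d k = 0")
  case False
  then show ?thesis using d by (intro exI[of _ d] exI[of _ "[]"]) (auto simp: less_le)
next
  case True
  define y where "y = (\<Sum>j\<in>UNIV. d j *\<^sub>R \<alpha>v j)"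
  define c where "c = - blinfun_apply (\<alpha> k) y"
  have c: "c = (\<Sum>j\<in>UNIV. d j * - of_int (A $ j $ k))"
    by (simp add: c_def y_def blinfun.sum_right blinfun.scaleR_right \<alpha>_\<alpha>v sum_negf)
  have nonneg: "0 \<le> d j * - of_int (A $ j $ k)" for j
    using True d(1)[of j] C.a_off[of k j] by (cases "j = k") (auto simp: mult_nonneg_nonpos)
  have "0 < d i * - of_int (A $ i $ k)"
    using d(2) C.a_off[of k i] assms(3,4) by (intro mult_pos_pos) (auto simp: less_le)
  also have "\<dots> \<le> c" unfolding c by (rule member_le_sum) (use nonneg in auto)
  finally have "0 < c" .
  have "(\<Sum>j\<in>UNIV. (d(k := c)) j *\<^sub>R \<alpha>v j) = y + c *\<^sub>R \<alpha>v k"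
    unfolding y_def sum.remove[of UNIV k, simplified] using True by (simp add: add.commute)
  also have "\<dots> = coact [k] y" by (simp add: C.act_Cons C.s_def c_def)
  finally show ?thesis using \<open>0 < c\<close> d(1)
    by (intro exI[of _ "d(k := c)"] exI[of _ "[k]"]) (auto simp: y_def)
qed

text \<open>Reflections along a path inside \<open>K\<close> extend the support to a node where
  \<open>\<mu>\<close> is positive. If \<open>i\<close> is only adjacent to \<open>K\<close>, one
  reflection first extends the support into \<open>K\<close>.\<close>

lemma mconn_orbit_positive:
  assumes "dominant \<mu>" "mconn \<mu> K" and d: "\<And>j. 0 \<le> d j" "0 < d i"
    and i: "i \<in> K \<or> blinfun_apply \<mu> (\<alpha>v i) \<noteq> 0 \<or> (\<exists>k\<in>K. i \<noteq> k \<and> A $ i $ k \<noteq> 0)"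
  shows "\<exists>us. set us \<subseteq> K \<and> 0 < blinfun_apply (act us \<mu>) (\<Sum>j\<in>UNIV. d j *\<^sub>R \<alpha>v j)"
proof -
  have path: "\<exists>us. set us \<subseteq> K \<and> 0 < blinfun_apply \<mu> (coact us (\<Sum>j\<in>UNIV. d j *\<^sub>R \<alpha>v j))"
    if "(i, k) \<in> (adj K)\<^sup>*" "blinfun_apply \<mu> (\<alpha>v k) \<noteq> 0" "\<And>j. 0 \<le> d j" "0 < d i" for i k d
    using that(1,3,4)
  proof (induction arbitrary: d rule: converse_rtrancl_induct)
    case base
    have nonneg: "0 \<le> d j * blinfun_apply \<mu> (\<alpha>v j)" for j
      using base(1) assms(1) by (simp add: dominant_def)
    have "0 < d k * blinfun_apply \<mu> (\<alpha>v k)"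
      using base(2) that(2) assms(1) by (simp add: dominant_def less_le)
    also have "\<dots> \<le> (\<Sum>j\<in>UNIV. d j * blinfun_apply \<mu> (\<alpha>v j))"
      by (rule member_le_sum) (use nonneg in auto)
    finally show ?case
      by (intro exI[of _ "[]"]) (simp add: blinfun.sum_right blinfun.scaleR_right)
  next
    case (step i i')
    have "i \<noteq> i'" "A $ i $ i' \<noteq> 0" "i' \<in> K" using step(1) by (auto simp: adj_def)
    from enlarge_support[of d, OF step.prems this(1,2)] obtain d' us
      where d': "\<forall>j. 0 \<le> d' j" "0 < d' i'" "set us \<subseteq> {i'}"
        "(\<Sum>j\<in>UNIV. d' j *\<^sub>R \<alpha>v j) = coact us (\<Sum>j\<in>UNIV. d j *\<^sub>R \<alpha>v j)" by blast
    obtain vs where "set vs \<subseteq> K" "0 < blinfun_apply \<mu> (coact vs (\<Sum>j\<in>UNIV. d' j *\<^sub>R \<alpha>v j))"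
      using step.IH[of d'] d' by blast
    then show ?case using d'(3) \<open>i' \<in> K\<close>
      by (intro exI[of _ "vs @ us"]) (auto simp: C.act_append d'(4))
  qed
  have in_K: "\<exists>us. set us \<subseteq> K \<and> 0 < blinfun_apply \<mu> (coact us (\<Sum>j\<in>UNIV. d j *\<^sub>R \<alpha>v j))"
    if "k \<in> K" "\<And>j. 0 \<le> d j" "0 < d k" for k d
  proof -
    have "\<exists>j. (k, j) \<in> (adj K)\<^sup>* \<and> blinfun_apply \<mu> (\<alpha>v j) \<noteq> 0"
      using assms(2) \<open>k \<in> K\<close> unfolding mconn_def by (rule bspec)
    then obtain j where j: "(k, j) \<in> (adj K)\<^sup>*" "blinfun_apply \<mu> (\<alpha>v j) \<noteq> 0"
      by (elim exE conjE)
    show ?thesis by (rule path[OF j]) (fact that)+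
  qed
  have "\<exists>us. set us \<subseteq> K \<and> 0 < blinfun_apply \<mu> (coact us (\<Sum>j\<in>UNIV. d j *\<^sub>R \<alpha>v j))"
    using i
  proof (elim disjE bexE conjE)
    assume "i \<in> K"
    then show ?thesis by (rule in_K) (fact d)+
  next
    assume "blinfun_apply \<mu> (\<alpha>v i) \<noteq> 0"
    then show ?thesis using d by (intro path[OF rtrancl_refl])
  next
    fix k assume k: "k \<in> K" "i \<noteq> k" "A $ i $ k \<noteq> 0"
    from enlarge_support[of d, OF d k(2,3)] obtain d' us
      where d': "\<forall>j. 0 \<le> d' j" "0 < d' k" "set us \<subseteq> {k}"
        "(\<Sum>j\<in>UNIV. d' j *\<^sub>R \<alpha>v j) = coact us (\<Sum>j\<in>UNIV. d j *\<^sub>R \<alpha>v j)" by blast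
    obtain vs where "set vs \<subseteq> K" "0 < blinfun_apply \<mu> (coact vs (\<Sum>j\<in>UNIV. d' j *\<^sub>R \<alpha>v j))"
      using in_K[OF k(1), of d'] d' by blast
    then show ?thesis using d'(3) k(1)
      by (intro exI[of _ "vs @ us"]) (auto simp: C.act_append d'(4))
  qed
  then obtain us where "set us \<subseteq> K" "0 < blinfun_apply \<mu> (coact us (\<Sum>j\<in>UNIV. d j *\<^sub>R \<alpha>v j))" by blast
  then show ?thesis by (intro exI[of _ "rev us"]) (simp add: act_pair)
qed

corollary mconn_coroot_positive:
  assumes "dominant \<mu>" "mconn \<mu> K"
    and "i \<in> K \<or> blinfun_apply \<mu> (\<alpha>v i) \<noteq> 0 \<or> (\<exists>k\<in>K. i \<noteq> k \<and> A $ i $ k \<noteq> 0)"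
  shows "\<exists>us. set us \<subseteq> K \<and> 0 < blinfun_apply (act us \<mu>) (\<alpha>v i)"
  using mconn_orbit_positive[OF assms(1,2), of "\<lambda>j. if j = i then 1 else 0" i] assms(3)
  by (simp add: if_distrib[of "\<lambda>c. c *\<^sub>R _"] cong: if_cong)

text \<open>Some orbit point is strictly on the positive side of the hyperplane of \<open>i\<close>.
  It and its reflection lie in the face, and they differ by a positive multiple of
  \<open>\<alpha> i\<close>.\<close>

lemma dirs_of_mconn:
  assumes "dominant \<mu>" "mconn \<mu> K" "F \<mu> K \<subseteq> G" "i \<in> K"
  shows "\<alpha> i \<in> dirs G"
proof -
  obtain us where us: "set us \<subseteq> K" "0 < blinfun_apply (act us \<mu>) (\<alpha>v i)"
    using mconn_coroot_positive[OF assms(1,2)] assms(4) by blast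
  define c where "c = blinfun_apply (act us \<mu>) (\<alpha>v i)"
  have "act us \<mu> \<in> G" "act (i # us) \<mu> \<in> G" using us assms(3,4) orb_F[of _ K \<mu>] by force+
  moreover have "\<alpha> i = (1 / c) *\<^sub>R (act us \<mu> - act (i # us) \<mu>)"
    using us(2) by (simp add: R.act_Cons R.s_def c_def)
  moreover have "0 \<le> 1 / c" using us(2) by (simp add: c_def)
  ultimately show ?thesis unfolding dirs_def by blast
qed

end

subsection \<open>Joins\<close>

context weyl_realization
begin

definition lstar :: "('h \<Rightarrow>\<^sub>L real) \<Rightarrow> 'i set \<Rightarrow> 'i set" where
  "lstar \<mu> K = {i. blinfun_apply \<mu> (\<alpha>v i) = 0 \<and> i \<notin> K \<and> (\<forall>k\<in>K. R.s i \<circ> R.s k = R.s k \<circ> R.s i)}"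

lemma s_commute:
  assumes "A $ i $ k = 0"
  shows "R.s i \<circ> R.s k = R.s k \<circ> R.s i"
  using assms R.a_zero[OF assms]
  by (auto simp: fun_eq_iff R.s_def R.f_e blinfun.bilinear_simps algebra_simps)

text \<open>Such an \<open>i\<close> fails to commute with some \<open>k\<close> in
  \<open>K\<close>, whereas reflections of nonadjacent nodes commute.\<close>

lemma not_lstar_adjacent:
  assumes "i \<notin> lstar \<mu> K" "i \<notin> K" "blinfun_apply \<mu> (\<alpha>v i) = 0"
  shows "\<exists>k\<in>K. i \<noteq> k \<and> A $ i $ k \<noteq> 0"
proof -
  obtain k where "k \<in> K" "R.s i \<circ> R.s k \<noteq> R.s k \<circ> R.s i" using assms unfolding lstar_def by blast
  then show ?thesis using s_commute[of i k] assms(2) by (intro bexI[of _ k]) auto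
qed

lemma lstar_commute_word:
  assumes "t \<in> lstar \<mu> K" "set us \<subseteq> K"
  shows "act (us @ [t]) = act (t # us)"
  using assms(2)
proof (induction us)
  case (Cons i us)
  have "R.s t \<circ> R.s i = R.s i \<circ> R.s t" using assms(1) Cons.prems by (auto simp: lstar_def)
  then have "R.s i (R.s t x) = R.s t (R.s i x)" for x by (metis comp_apply)
  moreover have "act (us @ [t]) x = act (t # us) x" for x using Cons by simp
  ultimately show ?case by (auto simp: R.act_Cons fun_eq_iff)
qed simp

lemma L_Cons: "R.L (act (i # us)) \<le> Suc (R.L (act us))"
proof -
  obtain vs where "act vs = act us" "length vs = R.L (act us)" using R.reduced_ex by blast
  then show ?thesis using R.L_le[of "i # vs"] by (simp add: R.act_Cons)
qed

text \<open>If \<open>i\<close> is new, either \<open>\<mu>\<close> is nonzero at \<open>i\<close>,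
  or \<open>i\<close> is adjacent to \<open>K\<close> and prolongs a path there.\<close>

lemma mconn_insert:
  assumes "mconn \<mu> K" "i \<notin> lstar \<mu> K"
  shows "mconn \<mu> (insert i K)"
  unfolding mconn_def
proof
  have mono: "(adj K)\<^sup>* \<subseteq> (adj (insert i K))\<^sup>*"
    by (intro rtrancl_mono adj_mono) blast
  have K: "\<exists>k. (j, k) \<in> (adj (insert i K))\<^sup>* \<and> blinfun_apply \<mu> (\<alpha>v k) \<noteq> 0" if "j \<in> K" for j
    using assms(1) that mono unfolding mconn_def by (meson subsetD)
  fix j assume "j \<in> insert i K"
  then consider "j \<in> K" | "j = i" "i \<notin> K" by blast
  then show "\<exists>k. (j, k) \<in> (adj (insert i K))\<^sup>* \<and> blinfun_apply \<mu> (\<alpha>v k) \<noteq> 0"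
  proof cases
    case 2
    show ?thesis
    proof (cases "blinfun_apply \<mu> (\<alpha>v i) = 0")
      case True
      then obtain k where "k \<in> K" "A $ i $ k \<noteq> 0"
        using not_lstar_adjacent assms(2) 2 by blast
      then have "(i, k) \<in> adj (insert i K)" using 2 by (auto simp: adj_def)
      with K[OF \<open>k \<in> K\<close>] show ?thesis unfolding 2(1) by (meson converse_rtrancl_into_rtrancl)
    next
      case False
      then show ?thesis using 2 by blast
    qed
  qed (rule K)
qed

lemma mconn_Un:
  assumes "mconn \<mu> K" "mconn \<mu> K'"
  shows "mconn \<mu> (K \<union> K')"
proof -
  have "(adj K)\<^sup>* \<subseteq> (adj (K \<union> K'))\<^sup>*" "(adj K')\<^sup>* \<subseteq> (adj (K \<union> K'))\<^sup>*"
    by (intro rtrancl_mono adj_mono; blast)+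
  then show ?thesis using assms unfolding mconn_def by (meson UnE subsetD)
qed

lemma no_descent_not_lstar:
  assumes "R.L (act (i # us)) = length (i # us)"
    and "\<And>t. t \<in> lstar \<mu> K \<Longrightarrow> R.L (act (i # us)) \<le> R.L (act (t # i # us))"
  shows "i \<notin> lstar \<mu> K"
proof
  assume "i \<in> lstar \<mu> K"
  then have "R.L (act (i # us)) \<le> R.L (act (i # i # us))" by (rule assms(2))
  also have "act (i # i # us) = act us" by (simp add: R.act_Cons fun_eq_iff)
  finally show False using R.L_le[of us] assms(1) by simp
qed

text \<open>Carries the descent hypothesis through the induction on the word: \<open>t\<close>
  commutes with \<open>i\<close>, so if it shortened \<open>us\<close> it would also shorten
  \<open>i # us\<close>.\<close>

lemma no_descent_tail:
  assumes "R.L (act (i # us)) = length (i # us)"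
    and "\<And>t. t \<in> lstar \<mu> K \<Longrightarrow> R.L (act (i # us)) \<le> R.L (act (t # i # us))"
    and t: "t \<in> lstar \<mu> (insert i K)"
  shows "R.L (act us) \<le> R.L (act (t # us))"
proof -
  have "t \<in> lstar \<mu> K" using t by (auto simp: lstar_def)
  then have "R.L (act (i # us)) \<le> R.L (act (t # i # us))" by (rule assms(2))
  also have "act (t # i # us) = act (i # t # us)"
    using t by (simp add: lstar_def R.act_Cons flip: comp_assoc)
  also have "R.L (act (i # t # us)) \<le> Suc (R.L (act (t # us)))" by (rule L_Cons)
  finally show ?thesis using assms(1) R.L_le[of us] by simp
qed

lemma mconn_Un_reduced:
  assumes "mconn \<mu> K" "R.L (act us) = length us"
    and "\<And>t. t \<in> lstar \<mu> K \<Longrightarrow> R.L (act us) \<le> R.L (act (t # us))"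
  shows "mconn \<mu> (K \<union> set us)"
  using assms
proof (induction us arbitrary: K)
  case (Cons i us)
  have "mconn \<mu> (insert i K)"
    using Cons.prems(1) no_descent_not_lstar[OF Cons.prems(2,3)] by (rule mconn_insert)
  from Cons.IH[OF this reduced_ConsD(1)[OF Cons.prems(2)] no_descent_tail[OF Cons.prems(2,3)]]
  show ?case by simp
qed simp

text \<open>The first letter \<open>i\<close> is absorbed into \<open>K\<close>. Once
  \<open>\<alpha> i\<close> is a direction of \<open>G\<close>, the face of
  \<open>insert i K\<close> lies in \<open>G\<close>, and reflecting in \<open>i\<close> reduces the
  second face to the one of the remaining word.\<close>

lemma face_contains_join:
  assumes dom: "dominant \<mu>" and K': "mconn \<mu> K'" and G: "G face_of F \<mu> UNIV"
    and "mconn \<mu> K" "F \<mu> K \<subseteq> G" "act us ` F \<mu> K' \<subseteq> G" "R.L (act us) = length us"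
    and "\<And>t. t \<in> lstar \<mu> K \<Longrightarrow> R.L (act us) \<le> R.L (act (t # us))"
    and "\<And>t. t \<in> K' \<union> lstar \<mu> K' \<Longrightarrow> R.L (act us) \<le> R.L (act (us @ [t]))"
  shows "F \<mu> (K \<union> K' \<union> set us) \<subseteq> G"
  using assms(4-)
proof (induction us arbitrary: K)
  case Nil
  have "\<mu> \<in> G" using Nil.prems(2) orb_F[of "[]" K \<mu>] by auto
  then show ?case
    using dirs_of_mconn[OF dom Nil.prems(1,2)] dirs_of_mconn[OF dom K', of G] Nil.prems(3)
    by (intro face_contains_F[OF dom G]) auto
next
  case (Cons i us)
  note left = Cons.prems(5) and right = Cons.prems(6)
  note reduced = Cons.prems(4)
  have i: "i \<notin> lstar \<mu> K" by (rule no_descent_not_lstar[OF reduced left])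
  have "\<mu> \<in> G" using Cons.prems(2) orb_F[of "[]" K \<mu>] by auto
  have dirs_K: "\<alpha> k \<in> dirs G" if "k \<in> K" for k
    using dirs_of_mconn[OF dom Cons.prems(1,2) that] .
  have dir_i: "\<alpha> i \<in> dirs G"
  proof (cases "i \<in> K")
    case False
    have "\<exists>k\<in>K. i \<noteq> k \<and> A $ i $ k \<noteq> 0" if "blinfun_apply \<mu> (\<alpha>v i) = 0"
      using not_lstar_adjacent[OF i False that] .
    \<comment> \<open>A point of the first face on the positive side of the hyperplane of
      \<open>i\<close>; one of the second face on the negative side follows.\<close>
    then obtain vs where vs: "set vs \<subseteq> K" "0 < blinfun_apply (act vs \<mu>) (\<alpha>v i)"
      using mconn_coroot_positive[OF dom Cons.prems(1), of i] by blast
    \<comment> \<open>As \<open>i\<close> is a left descent, the inverse of the word sends the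
      coroot of \<open>i\<close> to a negative one, whose negated coefficients are
      \<open>d\<close>.\<close>
    have "R.L (act (i # i # us)) \<le> R.L (act (i # us))"
    proof -
      have "act (i # i # us) = act us" by (simp add: R.act_Cons fun_eq_iff)
      then show ?thesis using R.L_le[of us] reduced by simp
    qed
    from coroot_negative_left[OF this] obtain d where d: "\<And>j. 0 \<le> d j"
      "- coact (rev (i # us)) (\<alpha>v i) = (\<Sum>j\<in>UNIV. d j *\<^sub>R \<alpha>v j)"
      unfolding C.pcone_def by auto
    \<comment> \<open>Otherwise \<open>right\<close> makes every term nonnegative after the word is
      applied, and \<open>- \<alpha>v i\<close> would lie in the cone.\<close>
    have "\<exists>j. 0 < d j \<and> j \<notin> K' \<union> lstar \<mu> K'"
    proof (rule ccontr)
      assume "\<not> ?thesis"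
      then have zero: "d j = 0" if "j \<notin> K' \<union> lstar \<mu> K'" for j using d(1)[of j] that by force
      have "d j *\<^sub>R coact (i # us) (\<alpha>v j) \<in> C.pcone" for j
      proof (cases "j \<in> K' \<union> lstar \<mu> K'")
        case True
        show ?thesis by (intro C.pcone_scale d coroot_positive right True)
      qed (use zero[of j] C.pcone_0 in auto)
      then have "(\<Sum>j\<in>UNIV. d j *\<^sub>R coact (i # us) (\<alpha>v j)) \<in> C.pcone" by (intro C.pcone_sum)
      also have "(\<Sum>j\<in>UNIV. d j *\<^sub>R coact (i # us) (\<alpha>v j)) = coact (i # us) (- coact (rev (i # us)) (\<alpha>v i))"
        unfolding d(2) C.act_sum by simp
      also have "\<dots> = - \<alpha>v i" by (simp only: C.act_simps C.act_rev_right)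
      finally show False using neg_coroot_notin by blast
    qed
    then obtain j where j: "0 < d j" "j \<notin> K' \<union> lstar \<mu> K'" by blast
    have "\<exists>k\<in>K'. j \<noteq> k \<and> A $ j $ k \<noteq> 0" if "blinfun_apply \<mu> (\<alpha>v j) = 0"
      using not_lstar_adjacent[of j \<mu> K'] j(2) that by blast
    then obtain bs where bs: "set bs \<subseteq> K'" "0 < blinfun_apply (act bs \<mu>) (\<Sum>j\<in>UNIV. d j *\<^sub>R \<alpha>v j)"
      using mconn_orbit_positive[OF dom K', of d j] d(1) j(1) by blast
    define \<eta> where "\<eta> = act (i # us) (act bs \<mu>)"
    have "blinfun_apply \<eta> (\<alpha>v i) = blinfun_apply (act bs \<mu>) (coact (rev (i # us)) (\<alpha>v i))"
      unfolding \<eta>_def by (rule act_pair)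
    also have "\<dots> = - blinfun_apply (act bs \<mu>) (\<Sum>j\<in>UNIV. d j *\<^sub>R \<alpha>v j)"
      unfolding d(2)[symmetric] blinfun.minus_right by simp
    finally have "blinfun_apply \<eta> (\<alpha>v i) < 0" using bs(2) by simp
    moreover have "\<eta> \<in> G" using Cons.prems(3) orb_F[OF bs(1), of \<mu>] unfolding \<eta>_def by blast
    moreover have "act vs \<mu> \<in> G" using Cons.prems(2) orb_F[OF vs(1), of \<mu>] by blast
    ultimately show ?thesis using vs(2) by (intro face_exchange[OF G])
  qed (rule dirs_K)
  have "mconn \<mu> (insert i K)" using Cons.prems(1) i by (rule mconn_insert)
  moreover have "F \<mu> (insert i K) \<subseteq> G"
    using dir_i dirs_K by (intro face_contains_F[OF dom G \<open>\<mu> \<in> G\<close>]) auto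
  moreover have "act us ` F \<mu> K' \<subseteq> G"
  proof safe
    fix x assume "x \<in> F \<mu> K'"
    then have "act (i # us) x \<in> G" using Cons.prems(3) by blast
    from face_reflect[OF G this dir_i] show "act us x \<in> G" by (simp add: R.act_Cons)
  qed
  moreover have "R.L (act us) \<le> R.L (act (us @ [t]))" if "t \<in> K' \<union> lstar \<mu> K'" for t
    using right[OF that] L_Cons[of i "us @ [t]"] reduced R.L_le[of us] by simp
  ultimately have "F \<mu> (insert i K \<union> K' \<union> set us) \<subseteq> G"
    using reduced_ConsD(1)[OF reduced] no_descent_tail[OF reduced left] by (intro Cons.IH)
  then show ?case by simp
qed

text \<open>Tested on a dominant \<open>\<rho>\<close> with value 1 at all simple coroots: each
  letter of a reduced word subtracts a strictly positive multiple of its root. So all letters of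
  \<open>us\<close> appear in the support of \<open>\<rho> - act us \<rho>\<close>, which
  \<open>set vs\<close> contains.\<close>

lemma reduced_letters:
  assumes "R.L (act us) = length us" "act us = act vs"
  shows "set us \<subseteq> set vs"
proof -
  obtain \<phi> :: "'i \<Rightarrow> 'h \<Rightarrow>\<^sub>L real" where \<phi>: "\<And>i j. blinfun_apply (\<phi> j) (\<alpha>v i) = (if i = j then 1 else 0)"
    using fundamental_weights by blast
  define \<rho> where "\<rho> = (\<Sum>j\<in>UNIV. \<phi> j)"
  have \<rho>: "blinfun_apply \<rho> (\<alpha>v i) = 1" for i by (simp add: \<rho>_def blinfun.sum_left \<phi>)
  have dom: "dominant \<rho>" by (simp add: dominant_def \<rho>)
  have "set us \<subseteq> K" if "supp (\<rho> - act us \<rho>) K" for K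
    using assms(1) that
  proof (induction us)
    case (Cons i us)
    note us = reduced_ConsD[OF Cons.prems(1)]
    obtain d where d: "\<And>j. 0 \<le> d j" "coact (rev us) (\<alpha>v i) = (\<Sum>j\<in>UNIV. d j *\<^sub>R \<alpha>v j)"
      using coroot_positive_left[OF us(2)] unfolding C.pcone_def by auto
    have "\<exists>j. d j \<noteq> 0"
    proof (rule ccontr)
      assume "\<nexists>j. d j \<noteq> 0"
      then have "coact (rev us) (\<alpha>v i) = 0" using d(2) by simp
      then have "coact us (coact (rev us) (\<alpha>v i)) = 0" by simp
      then show False using neg_coroot_notin[of i] C.pcone_0 by simp
    qed
    define c where "c = blinfun_apply (act us \<rho>) (\<alpha>v i)"
    have "c = (\<Sum>j\<in>UNIV. d j)"
      by (simp add: c_def act_pair d(2) blinfun.sum_right blinfun.scaleR_right \<rho>)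
    then have "0 < c" using d(1) \<open>\<exists>j. d j \<noteq> 0\<close> by (simp add: sum_nonneg less_le sum_nonneg_eq_0_iff)
    have "supp ((\<rho> - act us \<rho>) + c *\<^sub>R \<alpha> i) K"
      using Cons.prems(2) by (simp add: R.act_Cons R.s_def c_def algebra_simps)
    from supp_addD[OF this below_dominant[OF dom] R.pcone_scale[OF less_imp_le[OF \<open>0 < c\<close>] R.pcone_e]]
    have "supp (\<rho> - act us \<rho>) K" "supp (\<alpha> i) K" using \<open>0 < c\<close> by (auto dest: supp_scaleD)
    then show ?case using Cons.IH us(1) by (auto simp: supp_def split: if_splits)
  qed simp
  then show ?thesis using supp_act[of vs "set vs" \<rho>] assms(2) by simp
qed

text \<open>For minimality, a right factor \<open>q\<close> with letters in \<open>K'\<close> is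
  split off. It preserves \<open>F \<mu> K'\<close>, so the word may be replaced by
  \<open>p\<close>, which also has no right descent in \<open>K'\<close>, as
  \<open>face_contains_join\<close> demands.\<close>

theorem face_join_F:
  assumes dom: "dominant \<mu>" and K: "mconn \<mu> K" and K': "mconn \<mu> K'"
    and reduced: "R.L (act us) = length us"
    and left: "\<And>t. t \<in> lstar \<mu> K \<Longrightarrow> R.L (act us) \<le> R.L (act (t # us))"
    and right: "\<And>t. t \<in> lstar \<mu> K' \<Longrightarrow> R.L (act us) \<le> R.L (act (us @ [t]))"
  shows "face_join (F \<mu> UNIV) (F \<mu> K) (act us ` F \<mu> K') = F \<mu> (K \<union> K' \<union> set us)"
  unfolding face_join_def
proof (rule Least_equality, intro conjI)
  show "F \<mu> (K \<union> K' \<union> set us) face_of F \<mu> UNIV" by (rule F_face[OF dom])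
  show "F \<mu> K \<subseteq> F \<mu> (K \<union> K' \<union> set us)" by (rule F_mono) blast
  have "act us ` F \<mu> K' \<subseteq> act us ` F \<mu> (K \<union> K' \<union> set us)" by (intro image_mono F_mono) blast
  also have "\<dots> = F \<mu> (K \<union> K' \<union> set us)" by (rule act_F) blast
  finally show "act us ` F \<mu> K' \<subseteq> F \<mu> (K \<union> K' \<union> set us)" .
next
  fix G assume G: "G face_of F \<mu> UNIV \<and> F \<mu> K \<subseteq> G \<and> act us ` F \<mu> K' \<subseteq> G"
  obtain p q where pq: "act (p @ q) = act us" "length p + length q = R.L (act us)" "set q \<subseteq> K'"
    and p_right: "\<And>k. k \<in> K' \<Longrightarrow> R.L (act p) \<le> R.L (act (p @ [k]))"
    by (rule R.coset_decomposition[of us K']) blast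
  have p: "R.L (act p) = length p" using R.reduced_appendD(1)[of p q] pq by simp
  have "act us ` F \<mu> K' = act p ` F \<mu> K'"
    unfolding pq(1)[symmetric] R.act_append image_comp[symmetric] act_F[OF pq(3)] ..
  moreover have "R.L (act p) \<le> R.L (act (t # p))" if "t \<in> lstar \<mu> K" for t
  proof -
    have "act (t # us) = act ((t # p) @ q)"
      using pq(1) by (simp add: R.act_Cons)
    then show ?thesis using left[OF that] R.L_append[of "t # p" q] p pq(2) by simp
  qed
  moreover have "R.L (act p) \<le> R.L (act (p @ [t]))" if "t \<in> lstar \<mu> K'" for t
  proof -
    have "act (us @ [t]) = act p \<circ> act (q @ [t])"
      using pq(1) by (simp add: R.act_append flip: comp_assoc)
    \<comment> \<open>\<open>t\<close> commutes with the letters of \<open>q\<close> and moves past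
      them to \<open>p\<close>.\<close>
    also have "\<dots> = act ((p @ [t]) @ q)"
      unfolding lstar_commute_word[OF that pq(3)] by (simp add: R.act_append R.act_Cons comp_assoc)
    finally show ?thesis using right[OF that] R.L_append[of "p @ [t]" q] p pq(2) by simp
  qed
  ultimately have "F \<mu> (K \<union> K' \<union> set p) \<subseteq> G"
    using G p p_right by (intro face_contains_join[OF dom K' _ K]) auto
  \<comment> \<open>The letters lost with \<open>q\<close> belong to \<open>K'\<close>
    anyway.\<close>
  moreover have "set us \<subseteq> set p \<union> set q"
    using reduced_letters[OF reduced pq(1)[symmetric]] by simp
  then have "F \<mu> (K \<union> K' \<union> set us) \<subseteq> F \<mu> (K \<union> K' \<union> set p)"
    using pq(3) by (intro F_mono) blast
  ultimately show "F \<mu> (K \<union> K' \<union> set us) \<subseteq> G" by blast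
qed

end

subsection \<open>Intersections\<close>

context weyl_realization
begin

text \<open>The values at the coroots are carried along in the induction, because a reflection
  changes one coefficient by such a value.\<close>

lemma root_integral: "blinfun_apply (act us (\<alpha> j)) (\<omega> i) \<in> \<int>"
proof -
  have "blinfun_apply (act us (\<alpha> j)) (\<omega> i) \<in> \<int> \<and> blinfun_apply (act us (\<alpha> j)) (\<alpha>v k) \<in> \<int>" for i k
    by (induction us arbitrary: i k) (auto simp: R.act_Cons R.s_def blinfun.bilinear_simps \<alpha>_\<alpha>v)
  then show ?thesis by blast
qed

lemma supp_sumD:
  assumes "finite S" "supp (\<Sum>i\<in>S. c i *\<^sub>R x i) K" "\<And>i. i \<in> S \<Longrightarrow> 0 \<le> c i" "\<And>i. i \<in> S \<Longrightarrow> x i \<in> R.pcone"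
    and "i \<in> S" "c i \<noteq> 0"
  shows "supp (x i) K"
proof -
  have "(\<Sum>i\<in>S. c i *\<^sub>R x i) = c i *\<^sub>R x i + (\<Sum>i\<in>S - {i}. c i *\<^sub>R x i)"
    using assms(1,5) by (rule sum.remove)
  then have "supp (c i *\<^sub>R x i + (\<Sum>i\<in>S - {i}. c i *\<^sub>R x i)) K" using assms(2) by simp
  from supp_addD(1)[OF this] have "supp (c i *\<^sub>R x i) K"
    using assms by (auto intro!: R.pcone_scale R.pcone_sum)
  then show ?thesis using assms(6) by (rule supp_scaleD)
qed

lemma supp_sumI:
  assumes "\<And>i. i \<in> S \<Longrightarrow> c i \<noteq> 0 \<Longrightarrow> supp (x i) K"
  shows "supp (\<Sum>i\<in>S. c i *\<^sub>R x i) K"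
  unfolding supp_def
proof (intro allI impI)
  fix k assume "k \<notin> K"
  then have "c i = 0 \<or> blinfun_apply (x i) (\<omega> k) = 0" if "i \<in> S" for i
    using assms[OF that] by (auto simp: supp_def)
  then show "blinfun_apply (\<Sum>i\<in>S. c i *\<^sub>R x i) (\<omega> k) = 0"
    by (simp add: blinfun.sum_left blinfun.scaleR_left sum.neutral)
qed

text \<open>Both \<open>act us\<close> and its inverse send the simple roots in question to nonnegative
  combinations, so the coefficients involved are nonnegative integers with product 1.\<close>
lemma root_in_parabolic_simple:
  assumes pos: "act us (\<alpha> j) \<in> R.pcone" and inv_pos: "\<And>i. i \<in> K \<Longrightarrow> act (rev us) (\<alpha> i) \<in> R.pcone"
    and supp: "supp (act us (\<alpha> j)) K"
  shows "\<exists>i\<in>K. act us (\<alpha> j) = \<alpha> i"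
proof -
  define d where "d i = blinfun_apply (act us (\<alpha> j)) (\<omega> i)" for i
  have d: "0 \<le> d i" "d i \<in> \<int>" for i
    unfolding d_def by (intro pcone_nonneg pos root_integral)+
  have "act us (\<alpha> j) = (\<Sum>i\<in>K. d i *\<^sub>R \<alpha> i)"
    unfolding d_def using pos supp by (rule supp_expand)
  then have "act (rev us) (act us (\<alpha> j)) = (\<Sum>i\<in>K. d i *\<^sub>R act (rev us) (\<alpha> i))"
    by (simp only: R.act_sum R.act_simps)
  then have \<alpha>_j: "\<alpha> j = (\<Sum>i\<in>K. d i *\<^sub>R act (rev us) (\<alpha> i))" by simp
  have "\<alpha> j \<noteq> 0" using \<alpha>_\<omega>[of j j] by (metis blinfun.zero_left zero_neq_one)
  moreover have "\<alpha> j = 0" if "\<forall>i\<in>K. d i = 0" by (subst \<alpha>_j) (simp add: that)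
  ultimately obtain i where i: "i \<in> K" "d i \<noteq> 0" by blast
  \<comment> \<open>The terms are nonnegative and sum to \<open>\<alpha> j\<close>, so each term
    with \<open>d i \<noteq> 0\<close> is a multiple of \<open>\<alpha> j\<close>.\<close>
  have "supp (\<Sum>i\<in>K. d i *\<^sub>R act (rev us) (\<alpha> i)) {j}"
    unfolding \<alpha>_j[symmetric] by (simp add: supp_def)
  then have "supp (act (rev us) (\<alpha> i)) {j}"
    by (rule supp_sumD[rotated]) (use d inv_pos i in auto)
  from supp_expand[OF inv_pos[OF i(1)] this]
  obtain c where c: "act (rev us) (\<alpha> i) = c *\<^sub>R \<alpha> j" by auto
  have "c = blinfun_apply (act (rev us) (\<alpha> i)) (\<omega> j)" by (simp add: c blinfun.scaleR_left)
  then have "c \<in> \<int>" "0 \<le> c" using root_integral pcone_nonneg[OF inv_pos[OF i(1)]] by auto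
  have "\<alpha> i = c *\<^sub>R act us (\<alpha> j)" using c by (metis R.act_rev_right R.act_simps(3))
  then have "blinfun_apply (\<alpha> i) (\<omega> i) = c * d i" by (simp add: d_def blinfun.scaleR_left)
  then have "c * d i = 1" by simp
  obtain m n where mn: "c = of_int m" "d i = of_int n" using \<open>c \<in> \<int>\<close> d(2)[of i] by (auto elim!: Ints_cases)
  have "m * n = 1" using \<open>c * d i = 1\<close> unfolding mn by (metis of_int_1 of_int_eq_iff of_int_mult)
  moreover have "0 \<le> m" using \<open>0 \<le> c\<close> mn by simp
  ultimately have "m = 1" by (simp add: zmult_eq_1_iff)
  then show ?thesis using \<open>\<alpha> i = c *\<^sub>R act us (\<alpha> j)\<close> mn i(1) by (intro bexI[of _ i]) auto
qed

text \<open>The last letter \<open>k\<close> of a nonempty reduced word is a right descent, so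
  \<open>\<alpha> k\<close> would be sent to a negative root.\<close>

lemma act_eq_id:
  assumes "\<And>k. act us (\<alpha> k) = \<alpha> k"
  shows "act us = id"
proof -
  obtain vs where vs: "act vs = act us" "length vs = R.L (act us)" using R.reduced_ex by blast
  show ?thesis
  proof (cases vs rule: rev_cases)
    case (snoc ws k)
    have "act (us @ [k]) = act ws" using vs(1) snoc
      by (simp add: R.act_append R.act_Cons flip: vs(1)) (simp add: fun_eq_iff)
    then have "R.L (act (us @ [k])) \<le> R.L (act us)" using R.L_le[of ws] vs snoc by simp
    from R.length_decreasing_negative[OF this] have "- \<alpha> k \<in> R.pcone" by (simp add: assms)
    then have "\<alpha> k = 0" using pcone_antisym R.pcone_e by blast
    then show ?thesis using \<alpha>_\<omega>[of k k] by simp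
  qed (use vs in auto)
qed

text \<open>The product of \<open>s\<^sub>i\<close> and the conjugate of \<open>s\<^sub>j\<close> is a transvection \<open>\<eta> \<mapsto> \<eta> + \<eta>(x) \<alpha>\<^sub>i\<close>. It maps
  simple roots to roots, which are positive or negative; so it fixes all simple roots.\<close>
lemma conjugate_reflection:
  assumes "act us (\<alpha> j) = \<alpha> i"
  shows "act (us @ [j]) = act (i # us)"
proof -
  define x where "x = coact us (\<alpha>v j) - \<alpha>v i"
  define vs where "vs = i # us @ [j] @ rev us"
  have s_j: "act us (R.s j (act (rev us) \<eta>)) = \<eta> - blinfun_apply \<eta> (coact us (\<alpha>v j)) *\<^sub>R \<alpha> i" for \<eta>
    by (simp add: R.s_def assms act_pair)
  have x_i: "blinfun_apply (\<alpha> i) x = 0"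
  proof -
    have "blinfun_apply (\<alpha> i) (coact us (\<alpha>v j)) = blinfun_apply (\<alpha> j) (\<alpha>v j)"
      unfolding assms[symmetric] by (rule act_pair')
    then show ?thesis by (simp add: x_def blinfun.diff_right R.f_e R.a_diag)
  qed
  have vs: "act vs \<eta> = \<eta> + blinfun_apply \<eta> x *\<^sub>R \<alpha> i" for \<eta>
  proof -
    have "act vs \<eta> = R.s i (\<eta> - blinfun_apply \<eta> (coact us (\<alpha>v j)) *\<^sub>R \<alpha> i)"
      unfolding s_j[symmetric] by (simp add: vs_def R.act_Cons R.act_append)
    also have "\<dots> = \<eta> + blinfun_apply \<eta> x *\<^sub>R \<alpha> i"
      by (simp add: R.s_def R.f_e R.a_diag x_def blinfun.bilinear_simps algebra_simps flip: scaleR_2)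
    finally show ?thesis .
  qed
  have rev_vs: "act (rev vs) \<eta> = \<eta> - blinfun_apply \<eta> x *\<^sub>R \<alpha> i" for \<eta>
  proof -
    have "act vs (\<eta> - blinfun_apply \<eta> x *\<^sub>R \<alpha> i) = \<eta>"
      by (simp add: vs x_i blinfun.bilinear_simps)
    then show ?thesis by (metis R.act_rev_left)
  qed
  have sign: "act ws (\<alpha> k) \<in> R.pcone \<or> - act ws (\<alpha> k) \<in> R.pcone" for ws k
    using R.length_increasing_positive[of ws k] R.length_decreasing_negative[of ws k] by linarith
  \<comment> \<open>For \<open>k \<noteq> i\<close> the coefficient at \<open>k\<close> is 1, which
    excludes the negative sign. Used for \<open>vs\<close> and its inverse, this bounds the same
    number from both sides.\<close>
  have nonneg: "0 \<le> c" if "\<alpha> k + c *\<^sub>R \<alpha> i \<in> R.pcone \<or> - (\<alpha> k + c *\<^sub>R \<alpha> i) \<in> R.pcone" "k \<noteq> i" for k c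
  proof -
    have "- (\<alpha> k + c *\<^sub>R \<alpha> i) \<notin> R.pcone"
      using pcone_nonneg[of "- (\<alpha> k + c *\<^sub>R \<alpha> i)" k] that(2) by (auto simp: blinfun.bilinear_simps)
    then show ?thesis
      using pcone_nonneg[of "\<alpha> k + c *\<^sub>R \<alpha> i" i] that by (auto simp: blinfun.bilinear_simps)
  qed
  have "blinfun_apply (\<alpha> k) x = 0" for k
  proof (cases "k = i")
    case False
    then have "0 \<le> blinfun_apply (\<alpha> k) x" "0 \<le> - blinfun_apply (\<alpha> k) x"
      using nonneg[of k "blinfun_apply (\<alpha> k) x"] nonneg[of k "- blinfun_apply (\<alpha> k) x"]
        sign[of vs k] sign[of "rev vs" k] by (auto simp: vs rev_vs)
    then show ?thesis by simp
  qed (simp add: x_i)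
  then have id: "act vs = id" by (intro act_eq_id) (simp add: vs)
  have "act (us @ [j]) = act (i # i # us @ [j] @ rev us @ us)"
    by (simp add: fun_eq_iff R.act_Cons R.act_append)
  also have "\<dots> = act ((i # vs) @ us)" by (simp add: vs_def)
  also have "\<dots> = act (i # us)" unfolding R.act_append by (simp add: R.act_Cons id)
  finally show ?thesis .
qed

text \<open>The index version of \<open>I \<inter> w I'\<close>, where \<open>w\<close> is the element \<open>act us\<close>.\<close>
definition meet_set :: "'i list \<Rightarrow> 'i set \<Rightarrow> 'i set \<Rightarrow> 'i set" where
  "meet_set us K K' = {i \<in> K. \<exists>j\<in>K'. act us (\<alpha> j) = \<alpha> i}"

text \<open>The argument rests on \<open>\<mu> - x = (\<mu> - w \<mu>) + w (\<mu> - z)\<close>, where \<open>x = w z\<close>: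
  both summands are nonnegative, so both are supported on \<open>K\<close>.\<close>
lemma face_meet_subset:
  assumes dom: "dominant \<mu>"
    and left: "\<And>t. t \<in> K \<Longrightarrow> R.L (act us) \<le> R.L (act (t # us))"
    and right: "\<And>t. t \<in> K' \<Longrightarrow> R.L (act us) \<le> R.L (act (us @ [t]))"
    and x: "x \<in> F \<mu> K" "x \<in> act us ` F \<mu> K'"
  shows "act us \<mu> = \<mu> \<and> x \<in> F \<mu> (meet_set us K K')"
proof -
  obtain z where z: "z \<in> F \<mu> K'" "x = act us z" using x(2) by blast
  have z_H: "z \<in> F \<mu> UNIV" and x_H: "x \<in> F \<mu> UNIV"
    using z(1) x(1) F_mono[of _ UNIV \<mu>] by auto
  define c where "c j = blinfun_apply (\<mu> - z) (\<omega> j)" for j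
  have c: "0 \<le> c j" for j unfolding c_def by (intro pcone_nonneg F_below[OF dom z_H])
  have \<mu>_z: "\<mu> - z = (\<Sum>j\<in>K'. c j *\<^sub>R \<alpha> j)"
    unfolding c_def by (intro supp_expand F_below[OF dom z_H] F_supp z)
  have act_\<mu>_z: "act us (\<mu> - z) = (\<Sum>j\<in>K'. c j *\<^sub>R act us (\<alpha> j))"
    unfolding \<mu>_z R.act_sum by simp
  have right': "act us (\<alpha> j) \<in> R.pcone" if "j \<in> K'" for j
    by (intro R.length_increasing_positive right that)
  have left': "act (rev us) (\<alpha> i) \<in> R.pcone" if "i \<in> K" for i
    using left[OF that] R.L_rev[of us] R.L_rev[of "i # us"]
    by (intro R.length_increasing_positive) simp
  have "\<mu> - x = (\<mu> - act us \<mu>) + act us (\<mu> - z)" by (simp add: z(2))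
  then have "supp ((\<mu> - act us \<mu>) + act us (\<mu> - z)) K" using F_supp[OF x(1)] by simp
  from supp_addD[OF this below_dominant[OF dom]]
  have supp: "supp (\<mu> - act us \<mu>) K" "supp (act us (\<mu> - z)) K"
    unfolding act_\<mu>_z using c right' by (auto intro!: R.pcone_sum R.pcone_scale)
  obtain vs where vs: "set vs \<subseteq> K" "act vs \<mu> = act us \<mu>"
    "vs \<noteq> [] \<Longrightarrow> blinfun_apply (act us \<mu>) (\<alpha>v (hd vs)) < 0"
    using orbit_supp[OF dom supp(1)] by blast
  \<comment> \<open>The first letter would lie in \<open>K\<close>, where there are no left
    descents. So \<open>act us \<mu>\<close> is nonnegative at its coroot, against the choice of
    \<open>vs\<close>.\<close>
  have "vs = []"
  proof (rule ccontr)
    assume "vs \<noteq> []"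
    then have "hd vs \<in> K" using vs(1) hd_in_set by blast
    then have "0 \<le> blinfun_apply \<mu> (coact (rev us) (\<alpha>v (hd vs)))"
      by (intro dominant_pcone[OF dom] coroot_positive_left left)
    then show False using vs(3)[OF \<open>vs \<noteq> []\<close>] by (simp add: act_pair)
  qed
  then have stab: "act us \<mu> = \<mu>" using vs(2) by simp
  have "supp (\<mu> - x) (meet_set us K K')"
  proof -
    have "\<mu> - x = act us (\<mu> - z)" using stab by (simp add: z(2))
    also have "\<dots> = (\<Sum>j\<in>K'. c j *\<^sub>R act us (\<alpha> j))" by (rule act_\<mu>_z)
    also have "supp \<dots> (meet_set us K K')"
    proof (rule supp_sumI)
      fix j assume j: "j \<in> K'" "c j \<noteq> 0"
      have "supp (\<Sum>j\<in>K'. c j *\<^sub>R act us (\<alpha> j)) K" using supp(2) by (simp only: act_\<mu>_z)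
      then have "supp (act us (\<alpha> j)) K"
        by (rule supp_sumD[rotated]) (use c right' j in auto)
      from root_in_parabolic_simple[OF right'[OF j(1)] left' this]
      obtain i where "i \<in> K" "act us (\<alpha> j) = \<alpha> i" by blast
      then show "supp (act us (\<alpha> j)) (meet_set us K K')"
        using j(1) by (auto simp: supp_def meet_set_def)
    qed
    finally show ?thesis .
  qed
  then show ?thesis using stab x_H F_eq[OF dom, of "meet_set us K K'"] by blast
qed

text \<open>By \<open>conjugate_reflection\<close>, each letter of \<open>meet_set us K K'\<close>
  can be moved across \<open>act us\<close>, where it becomes a letter of \<open>K'\<close>.\<close>

lemma face_meet_supset:
  assumes "act us \<mu> = \<mu>"
  shows "F \<mu> (meet_set us K K') \<subseteq> F \<mu> K \<inter> act us ` F \<mu> K'"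
proof -
  have "\<exists>vs'. set vs' \<subseteq> K' \<and> act vs \<mu> = act us (act vs' \<mu>)" if "set vs \<subseteq> meet_set us K K'" for vs
    using that
  proof (induction vs)
    case Nil
    then show ?case using assms by (intro exI[of _ "[]"]) auto
  next
    case (Cons i vs)
    then obtain vs' where vs': "set vs' \<subseteq> K'" "act vs \<mu> = act us (act vs' \<mu>)" by auto
    obtain j where j: "j \<in> K'" "act us (\<alpha> j) = \<alpha> i" using Cons.prems by (auto simp: meet_set_def)
    have "R.s i (act us \<eta>) = act us (R.s j \<eta>)" for \<eta>
      using fun_cong[OF conjugate_reflection[OF j(2)], of \<eta>] by (simp add: R.act_Cons R.act_append)
    then show ?case using vs' j(1)
      by (intro exI[of _ "j # vs'"]) (simp add: R.act_Cons)
  qed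
  then have "orb \<mu> (meet_set us K K') \<subseteq> act us ` orb \<mu> K'"
    unfolding orb_def by blast
  then have "F \<mu> (meet_set us K K') \<subseteq> act us ` F \<mu> K'"
    unfolding F_def convex_hull_linear_image[OF R.linear_act] by (rule hull_mono)
  moreover have "F \<mu> (meet_set us K K') \<subseteq> F \<mu> K" by (rule F_mono) (auto simp: meet_set_def)
  ultimately show ?thesis by blast
qed

theorem face_meet:
  assumes "dominant \<mu>"
    and "\<And>t. t \<in> K \<Longrightarrow> R.L (act us) \<le> R.L (act (t # us))"
    and "\<And>t. t \<in> K' \<Longrightarrow> R.L (act us) \<le> R.L (act (us @ [t]))"
  shows "F \<mu> K \<inter> act us ` F \<mu> K' = (if act us \<mu> = \<mu> then F \<mu> (meet_set us K K') else {})"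
proof (cases "act us \<mu> = \<mu>")
  case True
  have "F \<mu> K \<inter> act us ` F \<mu> K' \<subseteq> F \<mu> (meet_set us K K')"
    using face_meet_subset[OF assms] by blast
  then show ?thesis using face_meet_supset[OF True, of K K'] True by auto
next
  case False
  have "x \<notin> act us ` F \<mu> K'" if "x \<in> F \<mu> K" for x
    using face_meet_subset[OF assms that] False by blast
  then show ?thesis using False by auto
qed

text \<open>The union of the components of \<open>K\<close> whose roots do not all lie in
  \<open>J0\<close>.\<close>

definition ustar :: "('h \<Rightarrow>\<^sub>L real) \<Rightarrow> 'i set \<Rightarrow> 'i set" where
  "ustar \<mu> K = {i \<in> K. \<exists>j. (i, j) \<in> (adj K)\<^sup>* \<and> blinfun_apply \<mu> (\<alpha>v j) \<noteq> 0}"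

lemma ustar_subset: "ustar \<mu> K \<subseteq> K"
  unfolding ustar_def by blast

text \<open>All nodes on a path to \<open>j\<close> reach \<open>j\<close> themselves, so the path
  stays inside \<open>ustar \<mu> K\<close>.\<close>

lemma mconn_ustar: "mconn \<mu> (ustar \<mu> K)"
  unfolding mconn_def
proof
  fix i assume "i \<in> ustar \<mu> K"
  then obtain j where i: "i \<in> K" and j: "(i, j) \<in> (adj K)\<^sup>*" "blinfun_apply \<mu> (\<alpha>v j) \<noteq> 0"
    unfolding ustar_def by blast
  have "(i, j) \<in> (adj (ustar \<mu> K))\<^sup>*" using j(1)
  proof (induction rule: converse_rtrancl_induct)
    case (step i k)
    then have "i \<in> ustar \<mu> K" "k \<in> ustar \<mu> K"
      using j(2) unfolding ustar_def by (auto simp: adj_def intro: converse_rtrancl_into_rtrancl)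
    then have "(i, k) \<in> adj (ustar \<mu> K)" using step.hyps(1) by (auto simp: adj_def)
    then show ?case using step.IH by (rule converse_rtrancl_into_rtrancl)
  qed simp
  then show "\<exists>j. (i, j) \<in> (adj (ustar \<mu> K))\<^sup>* \<and> blinfun_apply \<mu> (\<alpha>v j) \<noteq> 0" using j(2) by blast
qed

lemma ustar_greatest:
  assumes "mconn \<mu> N" "N \<subseteq> K"
  shows "N \<subseteq> ustar \<mu> K"
proof -
  have "(adj N)\<^sup>* \<subseteq> (adj K)\<^sup>*" using assms(2) by (intro rtrancl_mono adj_mono)
  then show ?thesis using assms unfolding mconn_def ustar_def by blast
qed

lemma F_ustar: "F \<mu> (ustar \<mu> K) = F \<mu> K"
proof -
  have "\<exists>vs'. set vs' \<subseteq> ustar \<mu> K \<and> act vs \<mu> = act vs' \<mu>" if "set vs \<subseteq> K" for vs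
    using that
  proof (induction vs)
    case (Cons i vs)
    then obtain vs' where vs': "set vs' \<subseteq> ustar \<mu> K" "act vs \<mu> = act vs' \<mu>" by auto
    show ?case
    proof (cases "i \<in> ustar \<mu> K")
      case True
      then show ?thesis using vs' by (intro exI[of _ "i # vs'"]) (simp add: R.act_Cons)
    next
      case False
      have zero: "blinfun_apply \<mu> (\<alpha>v i) = 0" using False Cons.prems unfolding ustar_def by auto
      have "A $ i $ k = 0" if "k \<in> ustar \<mu> K" for k
      proof (rule ccontr)
        assume "A $ i $ k \<noteq> 0"
        have k: "k \<in> K" "\<exists>j. (k, j) \<in> (adj K)\<^sup>* \<and> blinfun_apply \<mu> (\<alpha>v j) \<noteq> 0"
          using that by (simp_all add: ustar_def)
        from k(2) obtain j where j: "(k, j) \<in> (adj K)\<^sup>*" "blinfun_apply \<mu> (\<alpha>v j) \<noteq> 0"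
          by (elim exE conjE)
        have "i \<noteq> k" using False that by blast
        then have "(i, k) \<in> adj K" using \<open>A $ i $ k \<noteq> 0\<close> k(1) Cons.prems by (simp add: adj_def)
        then have "(i, j) \<in> (adj K)\<^sup>*" using j(1) by (rule converse_rtrancl_into_rtrancl)
        then show False using j(2) False Cons.prems by (auto simp: ustar_def)
      qed
      then have "i \<in> lstar \<mu> (ustar \<mu> K)" using zero False s_commute by (simp add: lstar_def)
      from fun_cong[OF lstar_commute_word[OF this vs'(1)], of \<mu>]
      have "act (i # vs') \<mu> = act vs' (R.s i \<mu>)"
        by (simp add: R.act_append R.act_Cons)
      then have "act (i # vs) \<mu> = act vs' \<mu>"
        using vs'(2) zero by (simp add: R.act_Cons R.s_def)
      then show ?thesis using vs'(1) by blast
    qed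
  qed (auto intro: exI[of _ "[]"])
  then have "orb \<mu> K \<subseteq> orb \<mu> (ustar \<mu> K)" unfolding orb_def by blast
  then have "orb \<mu> K = orb \<mu> (ustar \<mu> K)" using orb_mono[OF ustar_subset] by blast
  then show ?thesis by (simp add: F_def)
qed

end

subsection \<open>Comparison with the definitions\<close>

context weyl_realization
begin

lemma coroot_simple [simp]: "coroot \<alpha> \<alpha>v (\<alpha> i) = \<alpha>v i"
  by (simp add: coroot_def inj_\<alpha>)

lemma refl_simple: "refl \<alpha> \<alpha>v (\<alpha> i) = R.s i"
  by (simp add: fun_eq_iff refl_def R.s_def)

lemma inv_s: "m_inv GL (R.s i) = R.s i"
  unfolding m_inv_def
proof (rule the_equality)
  have "R.s i \<circ> R.s i = id" by (simp add: fun_eq_iff)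
  moreover have "bij (R.s i)" using R.bij_act[of "[i]"] by (simp add: R.act_Cons)
  ultimately show "R.s i \<in> carrier GL \<and> R.s i \<otimes>\<^bsub>GL\<^esub> R.s i = \<one>\<^bsub>GL\<^esub> \<and> R.s i \<otimes>\<^bsub>GL\<^esub> R.s i = \<one>\<^bsub>GL\<^esub>"
    by (simp add: GL_def R.linear_s)
next
  fix y assume "y \<in> carrier GL \<and> R.s i \<otimes>\<^bsub>GL\<^esub> y = \<one>\<^bsub>GL\<^esub> \<and> y \<otimes>\<^bsub>GL\<^esub> R.s i = \<one>\<^bsub>GL\<^esub>"
  then have "R.s i \<circ> y = id" by (simp add: GL_def)
  then show "y = R.s i" by (metis R.s_s comp_apply eq_id_iff ext)
qed

text \<open>The generators are involutions, so inverses contribute no further words.\<close>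

lemma parabolic_words: "parabolic \<alpha> \<alpha>v (\<alpha> ` K) = {act us | us. set us \<subseteq> K}"
proof -
  have S: "refl \<alpha> \<alpha>v ` \<alpha> ` K = R.s ` K" by (simp add: image_image refl_simple)
  have "w \<in> {act us | us. set us \<subseteq> K}" if "w \<in> generate GL (R.s ` K)" for w
    using that
  proof (induction rule: generate.induct)
    case one
    then show ?case by (auto simp: GL_def intro!: exI[of _ "[]"])
  next
    case (incl h)
    then obtain i where "i \<in> K" "h = R.s i" by blast
    then show ?case by (auto simp: R.act_Cons intro!: exI[of _ "[i]"])
  next
    case (inv h)
    then obtain i where "i \<in> K" "h = R.s i" by blast
    then show ?case by (auto simp: R.act_Cons inv_s intro!: exI[of _ "[i]"])
  next
    case (eng h1 h2)
    then obtain us vs where "h1 = act us" "h2 = act vs" "set us \<subseteq> K" "set vs \<subseteq> K" by blast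
    then show ?case by (auto simp: R.act_append GL_def intro!: exI[of _ "us @ vs"])
  qed
  moreover have "act us \<in> generate GL (R.s ` K)" if "set us \<subseteq> K" for us
    using that
  proof (induction us)
    case Nil
    have "\<one>\<^bsub>GL\<^esub> = act []" by (simp add: GL_def)
    then show ?case using generate.one[of GL "R.s ` K"] by (simp only:)
  next
    case (Cons i us)
    have "R.s i \<otimes>\<^bsub>GL\<^esub> act us \<in> generate GL (R.s ` K)"
      using Cons by (intro generate.eng[OF generate.incl]) auto
    moreover have "R.s i \<otimes>\<^bsub>GL\<^esub> act us = act (i # us)" unfolding R.act_Cons by (simp add: GL_def)
    ultimately show ?case by simp
  qed
  ultimately show ?thesis unfolding parabolic_def S by blast
qed

lemma weyl_group_words: "weyl_group \<alpha> \<alpha>v = range act"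
  unfolding weyl_group_def parabolic_words by auto

lemma expression_of_iff: "expression_of \<alpha> \<alpha>v \<beta>s w \<longleftrightarrow> (\<exists>us. \<beta>s = map \<alpha> us \<and> w = act us)"
proof -
  have "foldr (\<circ>) (map (refl \<alpha> \<alpha>v) (map \<alpha> us)) id = act us" for us
    by (induction us) (auto simp: R.act_Cons refl_simple)
  moreover have "set \<beta>s \<subseteq> range \<alpha> \<longleftrightarrow> (\<exists>us. \<beta>s = map \<alpha> us)"
    using ex_map_conv[of \<beta>s \<alpha>] by auto
  ultimately show ?thesis unfolding expression_of_def by metis
qed

lemma len_eq: "len \<alpha> \<alpha>v w = R.L w"
  unfolding len_def R.L_def expression_of_iff
  by (rule arg_cong[where f = Least]) force

lemma red_reduced_word:
  obtains vs where "act vs = act us" "R.L (act vs) = length vs" "red \<alpha> \<alpha>v (act us) = \<alpha> ` set vs"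
proof -
  let ?P = "\<lambda>\<beta>s. expression_of \<alpha> \<alpha>v \<beta>s (act us) \<and> length \<beta>s = len \<alpha> \<alpha>v (act us)"
  obtain vs where "act vs = act us" "length vs = R.L (act us)" using R.reduced_ex by blast
  then have "?P (map \<alpha> vs)" unfolding expression_of_iff len_eq by auto
  then have "?P (SOME \<beta>s. ?P \<beta>s)" by (rule someI)
  then obtain ws where "(SOME \<beta>s. ?P \<beta>s) = map \<alpha> ws" "act us = act ws" "length ws = R.L (act us)"
    unfolding expression_of_iff len_eq by auto
  then show ?thesis using that[of ws] by (simp add: red_def)
qed

text \<open>Multiplication by one generator stays in the double coset, so minimality excludes left
  descents in \<open>K\<close> and right descents in \<open>K'\<close>.\<close>

lemma min_double_coset_reps_descents:
  assumes "act us \<in> min_double_coset_reps \<alpha> \<alpha>v (\<alpha> ` K) (\<alpha> ` K')"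
  shows "\<And>t. t \<in> K \<Longrightarrow> R.L (act us) \<le> R.L (act (t # us))"
    and "\<And>t. t \<in> K' \<Longrightarrow> R.L (act us) \<le> R.L (act (us @ [t]))"
proof -
  have min: "R.L (act us) \<le> R.L (act (vs @ us @ ws))" if "set vs \<subseteq> K" "set ws \<subseteq> K'" for vs ws
  proof -
    have "R.L (act us) \<le> R.L (act vs \<circ> act us \<circ> act ws)"
      using assms that unfolding min_double_coset_reps_def parabolic_words len_eq by blast
    then show ?thesis by (simp add: R.act_append comp_assoc)
  qed
  show "R.L (act us) \<le> R.L (act (t # us))" if "t \<in> K" for t using min[of "[t]" "[]"] that by simp
  show "R.L (act us) \<le> R.L (act (us @ [t]))" if "t \<in> K'" for t using min[of "[]" "[t]"] that by simp
qed

lemma std_face_eq: "std_face \<alpha> \<alpha>v \<mu> (\<alpha> ` K) = F \<mu> K"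
proof -
  have "(\<lambda>w. w \<mu>) ` parabolic \<alpha> \<alpha>v (\<alpha> ` K) = orb \<mu> K" unfolding parabolic_words orb_def by blast
  then show ?thesis by (simp add: std_face_def F_def)
qed

lemma orbit_hull_eq: "orbit_hull \<alpha> \<alpha>v \<mu> = F \<mu> UNIV"
  using std_face_eq[of \<mu> UNIV] by (simp add: orbit_hull_def std_face_def weyl_group_def)

lemma J0_eq: "J0 \<alpha> \<alpha>v \<mu> = \<alpha> ` {i. blinfun_apply \<mu> (\<alpha>v i) = 0}"
  by (auto simp: J0_def)

lemma lower_star_eq: "lower_star \<alpha> \<alpha>v \<mu> (\<alpha> ` K) = \<alpha> ` lstar \<mu> K"
  unfolding lower_star_def J0_eq lstar_def by (auto simp: refl_simple inj_eq[OF inj_\<alpha>])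

lemma dynkin_adj_rtrancl:
  "(\<alpha> i, \<alpha> j) \<in> (Restr (dynkin_adj \<alpha> \<alpha>v) (\<alpha> ` K))\<^sup>* \<longleftrightarrow> (i, j) \<in> (adj K)\<^sup>*"
proof -
  let ?D = "Restr (dynkin_adj \<alpha> \<alpha>v) (\<alpha> ` K)"
  \<comment> \<open>\<open>dynkin_adj\<close> tests the transposed entry, as it evaluates the first
    root at the second coroot.\<close>
  have zero: "A $ j $ i = 0 \<longleftrightarrow> A $ i $ j = 0" for i j using R.a_zero by blast
  have D: "(\<beta>, \<gamma>) \<in> ?D \<longleftrightarrow> (\<exists>i j. \<beta> = \<alpha> i \<and> \<gamma> = \<alpha> j \<and> (i, j) \<in> adj K)" for \<beta> \<gamma>
    unfolding dynkin_adj_def adj_def by (auto simp: \<alpha>_\<alpha>v zero inj_eq[OF inj_\<alpha>] inj_image_mem_iff[OF inj_\<alpha>])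
  have "\<exists>j. \<gamma> = \<alpha> j \<and> (i, j) \<in> (adj K)\<^sup>*" if "(\<alpha> i, \<gamma>) \<in> ?D\<^sup>*" for \<gamma>
    using that
  proof (induction rule: rtrancl_induct)
    case (step \<beta> \<gamma>)
    then obtain k where k: "\<beta> = \<alpha> k" "(i, k) \<in> (adj K)\<^sup>*" by blast
    obtain k' j where "\<beta> = \<alpha> k'" "\<gamma> = \<alpha> j" "(k', j) \<in> adj K" using step.hyps(2) D by blast
    moreover from this k have "k' = k" by (simp add: inj_eq[OF inj_\<alpha>])
    ultimately show ?case using k(2) by (auto intro: rtrancl_into_rtrancl)
  qed blast
  moreover have "(\<alpha> i, \<alpha> j) \<in> ?D\<^sup>*" if "(i, j) \<in> (adj K)\<^sup>*"
    using that
  proof (induction rule: rtrancl_induct)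
    case (step k j)
    have "(\<alpha> k, \<alpha> j) \<in> ?D" using D step.hyps(2) by blast
    with step.IH show ?case by (rule rtrancl_into_rtrancl)
  qed simp
  ultimately show ?thesis by (metis inj_eq[OF inj_\<alpha>])
qed

lemma mu_connected_iff: "mu_connected \<alpha> \<alpha>v \<mu> (\<alpha> ` K) \<longleftrightarrow> mconn \<mu> K"
proof -
  let ?D = "Restr (dynkin_adj \<alpha> \<alpha>v) (\<alpha> ` K)"
  have "mu_connected \<alpha> \<alpha>v \<mu> (\<alpha> ` K) \<longleftrightarrow> (\<forall>i\<in>K. \<not> ?D\<^sup>* `` {\<alpha> i} \<subseteq> J0 \<alpha> \<alpha>v \<mu>)"
    by (auto simp: mu_connected_def conn_components_def quotient_def)
  also have "\<dots> \<longleftrightarrow> mconn \<mu> K"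
    unfolding mconn_def
  proof (intro ball_cong refl)
    fix i assume i: "i \<in> K"
    have range: "\<gamma> \<in> range \<alpha>" if "(\<alpha> i, \<gamma>) \<in> ?D\<^sup>*" for \<gamma>
      using that by (cases rule: rtranclE) (auto simp: dynkin_adj_def)
    show "(\<not> ?D\<^sup>* `` {\<alpha> i} \<subseteq> J0 \<alpha> \<alpha>v \<mu>) \<longleftrightarrow> (\<exists>j. (i, j) \<in> (adj K)\<^sup>* \<and> blinfun_apply \<mu> (\<alpha>v j) \<noteq> 0)"
    proof
      assume "\<not> ?D\<^sup>* `` {\<alpha> i} \<subseteq> J0 \<alpha> \<alpha>v \<mu>"
      then obtain \<gamma> where "(\<alpha> i, \<gamma>) \<in> ?D\<^sup>*" "\<gamma> \<notin> J0 \<alpha> \<alpha>v \<mu>" by blast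
      moreover from this range obtain j where "\<gamma> = \<alpha> j" by blast
      ultimately show "\<exists>j. (i, j) \<in> (adj K)\<^sup>* \<and> blinfun_apply \<mu> (\<alpha>v j) \<noteq> 0"
        by (auto simp: J0_eq dynkin_adj_rtrancl)
    next
      assume "\<exists>j. (i, j) \<in> (adj K)\<^sup>* \<and> blinfun_apply \<mu> (\<alpha>v j) \<noteq> 0"
      then obtain j where "(i, j) \<in> (adj K)\<^sup>*" "blinfun_apply \<mu> (\<alpha>v j) \<noteq> 0" by (elim exE conjE)
      then have "\<alpha> j \<in> ?D\<^sup>* `` {\<alpha> i}" "\<alpha> j \<notin> J0 \<alpha> \<alpha>v \<mu>"
        by (auto simp: dynkin_adj_rtrancl J0_eq inj_eq[OF inj_\<alpha>])
      then show "\<not> ?D\<^sup>* `` {\<alpha> i} \<subseteq> J0 \<alpha> \<alpha>v \<mu>" by blast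
    qed
  qed
  finally show ?thesis .
qed

lemma mu_connectedE:
  assumes "mu_connected \<alpha> \<alpha>v \<mu> I"
  obtains K where "I = \<alpha> ` K" "mconn \<mu> K"
proof -
  obtain K where "I = \<alpha> ` K" using assms unfolding mu_connected_def by (meson subset_imageE)
  then show ?thesis using that assms by (simp add: mu_connected_iff)
qed

lemma upper_star_eq: "upper_star \<alpha> \<alpha>v \<mu> (\<alpha> ` K) = \<alpha> ` ustar \<mu> K"
  unfolding upper_star_def
proof (rule Greatest_equality)
  show "\<alpha> ` ustar \<mu> K \<subseteq> \<alpha> ` K \<and> mu_connected \<alpha> \<alpha>v \<mu> (\<alpha> ` ustar \<mu> K)"
    unfolding mu_connected_iff using mconn_ustar[of \<mu> K] ustar_subset[of \<mu> K] by (intro conjI image_mono)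
next
  fix M assume M: "M \<subseteq> \<alpha> ` K \<and> mu_connected \<alpha> \<alpha>v \<mu> M"
  then obtain N where N: "M = \<alpha> ` N" "mconn \<mu> N" using mu_connectedE by blast
  then have "N \<subseteq> K" using M by (simp add: inj_image_subset_iff[OF inj_\<alpha>])
  then show "M \<subseteq> \<alpha> ` ustar \<mu> K" using ustar_greatest[OF N(2)] N(1) by blast
qed

lemma meet_set_image: "\<alpha> ` meet_set us K K' = \<alpha> ` K \<inter> act us ` \<alpha> ` K'"
  unfolding meet_set_def by force

lemma stabilizer_parabolic:
  assumes "dominant \<mu>"
  shows "act us \<in> parabolic \<alpha> \<alpha>v (J0 \<alpha> \<alpha>v \<mu>) \<longleftrightarrow> act us \<mu> = \<mu>"
proof
  assume "act us \<in> parabolic \<alpha> \<alpha>v (J0 \<alpha> \<alpha>v \<mu>)"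
  then obtain vs where "act us = act vs" "set vs \<subseteq> {i. blinfun_apply \<mu> (\<alpha>v i) = 0}"
    unfolding J0_eq parabolic_words by blast
  moreover have "act vs \<mu> = \<mu>" if "set vs \<subseteq> {i. blinfun_apply \<mu> (\<alpha>v i) = 0}" for vs
    using that by (induction vs) (auto simp: R.act_Cons R.s_def)
  ultimately show "act us \<mu> = \<mu>" by simp
next
  assume "act us \<mu> = \<mu>"
  from stabilizer[OF assms this] obtain vs
    where "act vs = act us" "set vs \<subseteq> {i. blinfun_apply \<mu> (\<alpha>v i) = 0}" by blast
  then show "act us \<in> parabolic \<alpha> \<alpha>v (J0 \<alpha> \<alpha>v \<mu>)"
    unfolding J0_eq parabolic_words mem_Collect_eq by (intro exI[of _ vs]) simp
qed

lemma min_double_coset_repsE: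
  assumes "w \<in> min_double_coset_reps \<alpha> \<alpha>v I I'"
  obtains us where "w = act us"
  using assms unfolding min_double_coset_reps_def weyl_group_words by blast

end

theorem theorem3p20:
  fixes A :: "int^'i^'i"
    and \<alpha> :: "'i::finite \<Rightarrow> 'h::euclidean_space \<Rightarrow>\<^sub>L real"
    and \<alpha>v :: "'i \<Rightarrow> 'h"
    and \<mu> :: "'h \<Rightarrow>\<^sub>L real"
  assumes "generalized_cartan_matrix A"
    and "realization A \<alpha> \<alpha>v"
    and "\<mu> \<in> fundamental_chamber \<alpha>v"
  shows
    "(\<forall>I I' w. mu_connected \<alpha> \<alpha>v \<mu> I \<and> mu_connected \<alpha> \<alpha>v \<mu> I' \<and>
        w \<in> min_double_coset_reps \<alpha> \<alpha>v I I' \<longrightarrow>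
        std_face \<alpha> \<alpha>v \<mu> I \<inter> w ` std_face \<alpha> \<alpha>v \<mu> I' =
          (if w \<in> parabolic \<alpha> \<alpha>v (J0 \<alpha> \<alpha>v \<mu>)
           then std_face \<alpha> \<alpha>v \<mu> (upper_star \<alpha> \<alpha>v \<mu> (I \<inter> w ` I')) else {})) \<and>
     (\<forall>I I' w. mu_connected \<alpha> \<alpha>v \<mu> I \<and> mu_connected \<alpha> \<alpha>v \<mu> I' \<and>
        w \<in> min_double_coset_reps \<alpha> \<alpha>v (lower_star \<alpha> \<alpha>v \<mu> I) (lower_star \<alpha> \<alpha>v \<mu> I') \<longrightarrow>
        mu_connected \<alpha> \<alpha>v \<mu> (I \<union> I' \<union> red \<alpha> \<alpha>v w) \<and>
        face_join (orbit_hull \<alpha> \<alpha>v \<mu>) (std_face \<alpha> \<alpha>v \<mu> I) (w ` std_face \<alpha> \<alpha>v \<mu> I') =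
          std_face \<alpha> \<alpha>v \<mu> (I \<union> I' \<union> red \<alpha> \<alpha>v w))"
proof -
  interpret weyl_realization A \<alpha> \<alpha>v using assms(1,2) by unfold_locales
  have dom: "dominant \<mu>" using assms(3) by (simp add: fundamental_chamber_def dominant_def)
  show ?thesis
  proof (intro conjI allI impI; elim conjE)
    fix I I' w
    assume I: "mu_connected \<alpha> \<alpha>v \<mu> I" and I': "mu_connected \<alpha> \<alpha>v \<mu> I'"
      and w: "w \<in> min_double_coset_reps \<alpha> \<alpha>v I I'"
    obtain K where K: "I = \<alpha> ` K" using I by (rule mu_connectedE)
    obtain K' where K': "I' = \<alpha> ` K'" using I' by (rule mu_connectedE)
    obtain us where us: "w = act us" using w by (rule min_double_coset_repsE)
    note descents = min_double_coset_reps_descents[OF w[unfolded K K' us]]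
    have "F \<mu> K \<inter> act us ` F \<mu> K' = (if act us \<mu> = \<mu> then F \<mu> (meet_set us K K') else {})"
      by (rule face_meet[OF dom descents])
    then show "std_face \<alpha> \<alpha>v \<mu> I \<inter> w ` std_face \<alpha> \<alpha>v \<mu> I' =
        (if w \<in> parabolic \<alpha> \<alpha>v (J0 \<alpha> \<alpha>v \<mu>)
         then std_face \<alpha> \<alpha>v \<mu> (upper_star \<alpha> \<alpha>v \<mu> (I \<inter> w ` I')) else {})"
      unfolding K K' us std_face_eq meet_set_image[symmetric] upper_star_eq F_ustar
        stabilizer_parabolic[OF dom] .
  next
    fix I I' w
    assume I: "mu_connected \<alpha> \<alpha>v \<mu> I" and I': "mu_connected \<alpha> \<alpha>v \<mu> I'"
      and w: "w \<in> min_double_coset_reps \<alpha> \<alpha>v (lower_star \<alpha> \<alpha>v \<mu> I) (lower_star \<alpha> \<alpha>v \<mu> I')"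
    obtain K where K: "I = \<alpha> ` K" "mconn \<mu> K" using I by (rule mu_connectedE)
    obtain K' where K': "I' = \<alpha> ` K'" "mconn \<mu> K'" using I' by (rule mu_connectedE)
    obtain us0 where "w = act us0" using w by (rule min_double_coset_repsE)
    \<comment> \<open>The word is the one chosen by \<open>red\<close>, so that its letters are
      exactly those in the claim.\<close>
    then obtain us where us: "w = act us" "R.L (act us) = length us" "red \<alpha> \<alpha>v w = \<alpha> ` set us"
      using red_reduced_word[of us0] by metis
    note descents = min_double_coset_reps_descents[OF w[unfolded K(1) K'(1) us(1) lower_star_eq]]
    have union: "I \<union> I' \<union> red \<alpha> \<alpha>v w = \<alpha> ` (K \<union> K' \<union> set us)"
      unfolding K(1) K'(1) us(3) by blast
    \<comment> \<open>The letters are absorbed into \<open>K\<close> from the left, and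
      \<open>K'\<close> is joined afterwards as a union of connected sets.\<close>
    have "mconn \<mu> ((K \<union> set us) \<union> K')"
      by (intro mconn_Un mconn_Un_reduced K(2) K'(2) us(2) descents(1))
    moreover have "(K \<union> set us) \<union> K' = K \<union> K' \<union> set us" by blast
    ultimately show "mu_connected \<alpha> \<alpha>v \<mu> (I \<union> I' \<union> red \<alpha> \<alpha>v w)"
      unfolding union mu_connected_iff by simp
    show "face_join (orbit_hull \<alpha> \<alpha>v \<mu>) (std_face \<alpha> \<alpha>v \<mu> I) (w ` std_face \<alpha> \<alpha>v \<mu> I') =
        std_face \<alpha> \<alpha>v \<mu> (I \<union> I' \<union> red \<alpha> \<alpha>v w)"
      unfolding union unfolding std_face_eq orbit_hull_eq K(1) K'(1) us(1)
      by (rule face_join_F[OF dom K(2) K'(2) us(2) descents])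
  qed
qed

end
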